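(* Let $K\ge1$ and $f=h+\overline g\in\mathcal{S}_H^0(K,\Omega)$, where $\Omega$ is a radial John disk. Then there are constants $\delta_1\in(0,1)$ and $C_4>0$ such that, for all $z\in\mathbb{D}$ with $|z|\ge\frac12$ and all $\zeta_1,\zeta_2\in B(z)$, $$|f(\zeta_1)-f(\zeta_2)|\le C_4\,d_\Omega(f(z))\left(\frac{|\zeta_1-\zeta_2|}{1-|z|}\right)^{\delta_1}.$$
   Context: $\mathbb{D}=\{z\in\mathbb{C}:|z|<1\}$. $\mathcal{S}_H$ is the family of sense-preserving harmonic univalent mappings $f=h+\overline{g}$ in $\mathbb{D}$, with $h,g$ analytic, $h(0)=g(0)=0$, $h'(0)=1$; $\mathcal{S}_H^0=\{f=h+\overline g\in\mathcal{S}_H: g'(0)=0\}$. Write $\|D_f\|=|f_z|+|f_{\overline z}|$. A sense-preserving homeomorphism $f$ of class $W^{1,2}_{loc}$ between domains is $K$-quasiconformal if $\|D_f(z)\|^2\le K\big||f_z|^2-|f_{\overline z}|^2\big|$. $\mathcal{S}_H^0(K,\Omega)$ denotes the set of $K$-quasiconformal $f\in\mathcal{S}_H^0$ with $f(\mathbb{D})=\Omega$. For a domain $G$, $d_G(w)$ is the Euclidean distance from $w$ to $\partial G$. For univalent $f$ on $\mathbb{D}$, a bounded simply connected domain $G=f(\mathbb{D})$ is a radial $c$-John disk ($c\ge1$) with John center $f(0)$ if for every $z\in\mathbb{D}$ the curve $\gamma=f([0,z])$, joining $w_1=f(z)$ to $f(0)$, is rectifiable and satisfies: for every $w\in\gamma$,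 the Euclidean length of the subarc $\gamma[w_1,w]$ of $\gamma$ between $w_1$ and $w$ is at most $c\,d_G(w)$. $G$ is a radial John disk if it is a radial $c$-John disk for some $c\ge1$. For $z\in\mathbb{D}$, $B(z)=\{\zeta: |z|\le|\zeta|<1,\ |\arg z-\arg\zeta|\le\pi(1-|z|)\}$ (differences of arguments taken modulo $2\pi$). *)

theory Defs
  imports "HOL-Complex_Analysis.Complex_Analysis"
begin

abbreviation unit_disk :: "complex set"
  where "unit_disk \<equiv> ball 0 1"

definition plane_domain :: "complex set \<Rightarrow> bool"
  where "plane_domain G \<longleftrightarrow> open G \<and> connected G \<and> G \<noteq> {}"

definition boundary_dist :: "complex set \<Rightarrow> complex \<Rightarrow> real"
  where "boundary_dist G w = infdist w (frontier G)"

text \<open>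
  A map that is continuous and injective on an open set is sense-preserving there if it
  has local degree 1, that is, if it maps every positively oriented circle bounding a disk
  in the set to a loop that winds once around the image of the centre.
\<close>

definition sense_preserving_on :: "(complex \<Rightarrow> complex) \<Rightarrow> complex set \<Rightarrow> bool"
  where "sense_preserving_on f U \<longleftrightarrow>
    (\<forall>a r. 0 < r \<and> cball a r \<subseteq> U \<longrightarrow> winding_number (f \<circ> circlepath a r) (f a) = 1)"

definition wirtinger_z :: "(complex \<Rightarrow> complex) \<Rightarrow> complex \<Rightarrow> complex"
  where "wirtinger_z f z =
    (frechet_derivative f (at z) 1 - \<i> * frechet_derivative f (at z) \<i>) / 2"

definition wirtinger_zbar :: "(complex \<Rightarrow> complex) \<Rightarrow> complex \<Rightarrow> complex"
  where "wirtinger_zbar f z =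
    (frechet_derivative f (at z) 1 + \<i> * frechet_derivative f (at z) \<i>) / 2"

definition op_norm_D :: "(complex \<Rightarrow> complex) \<Rightarrow> complex \<Rightarrow> real"
  where "op_norm_D f z = norm (wirtinger_z f z) + norm (wirtinger_zbar f z)"

definition locally_L2 :: "complex set \<Rightarrow> (complex \<Rightarrow> complex) \<Rightarrow> bool"
  where "locally_L2 U u \<longleftrightarrow> set_borel_measurable lebesgue U u \<and>
    (\<forall>C. compact C \<and> C \<subseteq> U \<longrightarrow> set_integrable lebesgue C (\<lambda>z. (norm (u z))\<^sup>2))"

text \<open>
  Test functions are taken to be of class C1 with compact support; by mollification this
  gives the same weak derivatives as smooth test functions.
\<close>

definition test_function :: "complex set \<Rightarrow> (complex \<Rightarrow> real) \<Rightarrow> bool"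
  where "test_function U \<phi> \<longleftrightarrow>
    (\<forall>z. \<phi> differentiable (at z)) \<and>
    (\<forall>v. continuous_on UNIV (\<lambda>z. frechet_derivative \<phi> (at z) v)) \<and>
    compact (closure {z. \<phi> z \<noteq> 0}) \<and> closure {z. \<phi> z \<noteq> 0} \<subseteq> U"

definition weak_partial :: "complex set \<Rightarrow> complex \<Rightarrow> (complex \<Rightarrow> complex) \<Rightarrow> (complex \<Rightarrow> complex) \<Rightarrow> bool"
  where "weak_partial U v u u' \<longleftrightarrow>
    (\<forall>\<phi>. test_function U \<phi> \<longrightarrow>
      (LINT z:U|lebesgue. frechet_derivative \<phi> (at z) v *\<^sub>R u z) =
      - (LINT z:U|lebesgue. \<phi> z *\<^sub>R u' z))"

definition W12_loc :: "complex set \<Rightarrow> (complex \<Rightarrow> complex) \<Rightarrow> bool"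
  where "W12_loc U u \<longleftrightarrow> locally_L2 U u \<and>
    (\<exists>ux uy. locally_L2 U ux \<and> locally_L2 U uy \<and> weak_partial U 1 u ux \<and> weak_partial U \<i> u uy)"

text \<open>
  A homeomorphism of class W12_loc between plane domains is differentiable almost
  everywhere (Gehring and Lehto) and its weak derivatives agree almost everywhere with the
  classical ones, so the distortion inequality is imposed almost everywhere on the
  classical derivatives.
\<close>

definition quasiconformal :: "real \<Rightarrow> (complex \<Rightarrow> complex) \<Rightarrow> complex set \<Rightarrow> complex set \<Rightarrow> bool"
  where "quasiconformal K f U V \<longleftrightarrow>
    plane_domain U \<and> plane_domain V \<and> (\<exists>g. homeomorphism U V f g) \<and>
    sense_preserving_on f U \<and> W12_loc U f \<and>
    (AE z in lebesgue. z \<in> U \<longrightarrow>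
      (op_norm_D f z)\<^sup>2 \<le> K * \<bar>(norm (wirtinger_z f z))\<^sup>2 - (norm (wirtinger_zbar f z))\<^sup>2\<bar>)"

definition S_H_decomp :: "(complex \<Rightarrow> complex) \<Rightarrow> (complex \<Rightarrow> complex) \<Rightarrow> (complex \<Rightarrow> complex) \<Rightarrow> bool"
  where "S_H_decomp f h g \<longleftrightarrow>
    h holomorphic_on unit_disk \<and> g holomorphic_on unit_disk \<and>
    (\<forall>z\<in>unit_disk. f z = h z + cnj (g z)) \<and>
    h 0 = 0 \<and> g 0 = 0 \<and> deriv h 0 = 1 \<and>
    inj_on f unit_disk \<and> sense_preserving_on f unit_disk"

definition S_H :: "(complex \<Rightarrow> complex) set"
  where "S_H = {f. \<exists>h g. S_H_decomp f h g}"

definition S_H0 :: "(complex \<Rightarrow> complex) set"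
  where "S_H0 = {f \<in> S_H. \<exists>h g. S_H_decomp f h g \<and> deriv g 0 = 0}"

definition S_H0_qc :: "real \<Rightarrow> complex set \<Rightarrow> (complex \<Rightarrow> complex) set"
  where "S_H0_qc K \<Omega> = {f \<in> S_H0. f ` unit_disk = \<Omega> \<and> quasiconformal K f unit_disk \<Omega>}"

definition curve_length :: "(real \<Rightarrow> complex) \<Rightarrow> real \<Rightarrow> real \<Rightarrow> ennreal"
  where "curve_length \<gamma> a b =
    (SUP (n, t) \<in> {(n :: nat, t :: nat \<Rightarrow> real). incseq t \<and> range t \<subseteq> {a..b}}.
      \<Sum>i<n. ennreal (dist (\<gamma> (t i)) (\<gamma> (t (Suc i)))))"

text \<open>
  The image of the radius from 0 to z is parametrised on the unit interval from the John
  centre f 0 to f z. Since f is injective, the subarc between f z and the point with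
  parameter s is the part over {s..1}.
\<close>

definition radial_c_John_disk :: "real \<Rightarrow> (complex \<Rightarrow> complex) \<Rightarrow> complex set \<Rightarrow> bool"
  where "radial_c_John_disk c f G \<longleftrightarrow>
    1 \<le> c \<and> inj_on f unit_disk \<and> G = f ` unit_disk \<and>
    plane_domain G \<and> bounded G \<and> simply_connected G \<and>
    (\<forall>z\<in>unit_disk. let \<gamma> = f \<circ> linepath 0 z in
      curve_length \<gamma> 0 1 < \<infinity> \<and>
      (\<forall>s\<in>{0..1}. curve_length \<gamma> s 1 \<le> ennreal (c * boundary_dist G (\<gamma> s))))"

definition radial_John_disk :: "(complex \<Rightarrow> complex) \<Rightarrow> complex set \<Rightarrow> bool"
  where "radial_John_disk f G \<longleftrightarrow> (\<exists>c. radial_c_John_disk c f G)"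

text \<open>
  The integer k realises the difference of arguments modulo 2 pi. For z = 0, where the
  argument is undefined, the condition on arguments is void and the set is the unit disk.
\<close>

definition Carleson_box :: "complex \<Rightarrow> complex set"
  where "Carleson_box z =
    {\<zeta>. norm z \<le> norm \<zeta> \<and> norm \<zeta> < 1 \<and>
      (\<exists>k::int. \<bar>Arg z - Arg \<zeta> + 2 * pi * of_int k\<bar> \<le> pi * (1 - norm z))}"

end

theory Submission
  imports Defs
begin

text \<open>
  Write d(z) for the distance from f z to the boundary. Two length-area estimates drive the
  proof. First, some circle about z of radius comparable with 1 - |z| has its image within
  C d(z) of f z, since every such image has to meet the disk of radius d(z) about f z; growth
  bounds for the holomorphic functions h + g and h - g then make f Lipschitz near z with
  constant C d(z) / (1 - |z|). Second, on every radial segment from r to (1 + r) / 2 the map f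
  moves by at least epsilon d. By the John condition the sum of these displacements along the
  dyadic points beyond r is at most c d(r), so d decays geometrically along them, that is,
  like a power of 1 - r.

  For two points of the box at distance t, either the Lipschitz bound applies directly or one
  moves along both radii inwards to distance about t from the circle, at a cost controlled by the
  John condition and the decay of d, and crosses there with the Lipschitz bound.
\<close>

section \<open>Area of images of injective plane maps\<close>

text \<open>Both length-area estimates are instances of one inequality about vertical segments in a
  strip. This works because composing f with a holomorphic k keeps the form h + cnj g and the
  distortion constant K: z + exp turns vertical segments into arcs of circles about z, and a
  rotation turns them into segments at 45 degrees to a radius. The inequality rests on the change of
  variables for injective maps only, and its constants are scale invariant, hence independent of z.

  The obstacle is that no continuity of f up to the unit circle is available. Reaching the boundary
  is therefore replaced by compactness: outside some smaller disk f stays farther than d(z) / 2 from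
  f z, and the curves stop there.

  Harmonicity enters twice. The real and imaginary parts of f are real parts of holomorphic
  functions, which turns a bound on one circle into a Lipschitz bound; and continuity of h' and g'
  turns the almost everywhere distortion inequality into one at every point. The exponent comes from
  the decay of d alone; all other steps cost only constant factors.\<close>

definition vec_complex :: "real^2 \<Rightarrow> complex" where "vec_complex v = Complex (v $ 1) (v $ 2)"
definition complex_vec :: "complex \<Rightarrow> real^2" where "complex_vec z = vector [Re z, Im z]"

lemma vec_complex_inverse [simp]: "vec_complex (complex_vec z) = z"
  by (simp add: vec_complex_def complex_vec_def)

lemma complex_vec_inverse [simp]: "complex_vec (vec_complex v) = v"
  by (simp add: vec_complex_def complex_vec_def vec_eq_iff forall_2)

lemma bounded_linear_vec_complex: "bounded_linear vec_complex"
  by (simp add: linear_conv_bounded_linear[symmetric], intro linearI; simp add: vec_complex_def complex_eq_iff)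

lemma bounded_linear_complex_vec: "bounded_linear complex_vec"
  by (simp add: linear_conv_bounded_linear[symmetric], intro linearI; simp add: complex_vec_def vec_eq_iff forall_2)

lemma norm_complex_vec: "norm (complex_vec z) = norm z"
  by (simp add: norm_vec_def L2_set_def UNIV_2 complex_vec_def cmod_def)

text \<open>A box and its preimage have the same side lengths, and Lebesgue measure is determined by
  boxes. Integrals over the plane can thus be moved to \<open>real^2\<close>, where the Jacobian is
  a determinant.\<close>

lemma distr_lborel_vec_complex: "distr lborel borel vec_complex = lborel"
proof (rule lborel_eqI[symmetric])
  fix l u :: complex
  assume lu: "\<And>b. b \<in> Basis \<Longrightarrow> l \<bullet> b \<le> u \<bullet> b"
  have m: "vec_complex \<in> borel_measurable borel"
    by (intro borel_measurable_continuous_onI linear_continuous_on bounded_linear_vec_complex)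
  have le: "Re l \<le> Re u" "Im l \<le> Im u" using lu[of 1] lu[of \<i>] by (auto simp: Basis_complex_def)
  have "vec_complex -` box l u = box (complex_vec l) (complex_vec u)"
    by (auto simp: box_def Basis_complex_def vec_complex_def complex_vec_def Basis_vec_def inner_axis UNIV_2)
  then have "emeasure (distr lborel borel vec_complex) (box l u) = emeasure lborel (box (complex_vec l) (complex_vec u))"
    using m by (simp add: emeasure_distr)
  also have "\<dots> = (\<Prod>b\<in>Basis. (complex_vec u - complex_vec l) \<bullet> b)"
    using le by (intro emeasure_lborel_box) (auto simp: Basis_vec_def inner_axis UNIV_2 complex_vec_def)
  also have "(\<Prod>b\<in>Basis. (complex_vec u - complex_vec l) \<bullet> b) = (Re u - Re l) * (Im u - Im l)"
  proof -
    have B: "(Basis :: (real^2) set) = {axis 1 1, axis 2 1}"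
      by (auto simp: Basis_vec_def UNIV_2)
    have "axis 1 1 \<noteq> (axis 2 1 :: real^2)" by (simp add: axis_eq_axis)
    then show ?thesis
      unfolding B by (simp add: inner_axis complex_vec_def)
  qed
  also have "\<dots> = (\<Prod>b\<in>Basis. (u - l) \<bullet> b)"
    by (simp add: Basis_complex_def)
  finally show "emeasure (distr lborel borel vec_complex) (box l u) = (\<Prod>b\<in>Basis. (u - l) \<bullet> b)" .
qed simp

lemma distr_lborel_Complex:
  "distr (lborel \<Otimes>\<^sub>M lborel) borel (\<lambda>(x, y). Complex x y) = lborel"
proof (rule lborel_eqI[symmetric])
  fix l u :: complex
  assume lu: "\<And>b. b \<in> Basis \<Longrightarrow> l \<bullet> b \<le> u \<bullet> b"
  have m: "(\<lambda>(x, y). Complex x y) \<in> borel_measurable (lborel \<Otimes>\<^sub>M lborel)"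
    unfolding lborel_prod
    by (simp add: split_beta') (intro borel_measurable_continuous_onI continuous_intros; simp)
  have le: "Re l \<le> Re u" "Im l \<le> Im u" using lu[of 1] lu[of \<i>] by (auto simp: Basis_complex_def)
  have "(\<lambda>(x, y). Complex x y) -` box l u = {Re l<..<Re u} \<times> {Im l<..<Im u}"
    by (auto simp: box_def Basis_complex_def)
  then have "emeasure (distr (lborel \<Otimes>\<^sub>M lborel) borel (\<lambda>(x, y). Complex x y)) (box l u)
      = emeasure (lborel \<Otimes>\<^sub>M lborel) ({Re l<..<Re u} \<times> {Im l<..<Im u})"
    using m by (simp add: emeasure_distr space_pair_measure)
  also have "\<dots> = ennreal ((Re u - Re l) * (Im u - Im l))"
    using le by (simp add: lborel.emeasure_pair_measure_Times ennreal_mult)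
  also have "\<dots> = (\<Prod>b\<in>Basis. (u - l) \<bullet> b)"
    by (simp add: Basis_complex_def)
  finally show "emeasure (distr (lborel \<Otimes>\<^sub>M lborel) borel (\<lambda>(x, y). Complex x y)) (box l u) = (\<Prod>b\<in>Basis. (u - l) \<bullet> b)" .
qed simp

lemma nn_integral_complex_iterated:
  assumes "u \<in> borel_measurable borel"
  shows "(\<integral>\<^sup>+z. u z \<partial>lborel) = (\<integral>\<^sup>+x. \<integral>\<^sup>+y. u (Complex x y) \<partial>lborel \<partial>lborel)"
proof -
  have m: "(\<lambda>(x, y). Complex x y) \<in> borel_measurable (lborel \<Otimes>\<^sub>M lborel)"
    unfolding lborel_prod
    by (simp add: split_beta') (intro borel_measurable_continuous_onI continuous_intros; simp)
  have "(\<integral>\<^sup>+z. u z \<partial>lborel) = (\<integral>\<^sup>+p. u (case p of (x, y) \<Rightarrow> Complex x y) \<partial>(lborel \<Otimes>\<^sub>M lborel))"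
    by (subst distr_lborel_Complex[symmetric], subst nn_integral_distr[OF m]) (use assms in auto)
  also have "\<dots> = (\<integral>\<^sup>+x. \<integral>\<^sup>+y. u (Complex x y) \<partial>lborel \<partial>lborel)"
    using m assms by (subst lborel.nn_integral_fst[symmetric]) auto
  finally show ?thesis .
qed

text \<open>The determinant of an \<real>-linear map of the plane: its columns are L 1 and L
  \<i>.\<close>

definition real_Jacobian :: "(complex \<Rightarrow> complex) \<Rightarrow> real"
  where "real_Jacobian L = Re (L 1) * Im (L \<i>) - Im (L 1) * Re (L \<i>)"

text \<open>By injectivity no part of the image is counted twice, so the integral is the area of F
  S, which lies in a disk of radius R. The absolute value makes orientation irrelevant.\<close>

lemma nn_integral_Jacobian_le:
  fixes F :: "complex \<Rightarrow> complex"
  assumes S: "S \<in> sets borel"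
    and der: "\<And>z. z \<in> S \<Longrightarrow> (F has_derivative F' z) (at z)"
    and inj: "inj_on F S"
    and sub: "F ` S \<subseteq> ball w R" and R: "0 \<le> R"
    and meas: "(\<lambda>z. indicator S z * \<bar>real_Jacobian (F' z)\<bar>) \<in> borel_measurable borel"
  shows "(\<integral>\<^sup>+z. ennreal (indicator S z * \<bar>real_Jacobian (F' z)\<bar>) \<partial>lborel) \<le> ennreal (pi * R\<^sup>2)"
proof -
  define T where "T = vec_complex -` S"
  define g where "g = complex_vec \<circ> F \<circ> vec_complex"
  define g' where "g' v = complex_vec \<circ> F' (vec_complex v) \<circ> vec_complex" for v
  have m: "vec_complex \<in> borel_measurable borel"
    by (intro borel_measurable_continuous_onI linear_continuous_on bounded_linear_vec_complex)
  have T: "T \<in> sets borel" unfolding T_def using measurable_sets[OF m S] by simp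
  then have TL: "T \<in> sets lebesgue" by (simp add: borel_measurable_if_D)
  have dg: "(g has_derivative g' v) (at v within T)" if "v \<in> T" for v
  proof -
    have "(F has_derivative F' (vec_complex v)) (at (vec_complex v))"
      using der that by (auto simp: T_def)
    then have "(F \<circ> vec_complex has_derivative F' (vec_complex v) \<circ> vec_complex) (at v)"
      by (rule diff_chain_at[OF bounded_linear_imp_has_derivative[OF bounded_linear_vec_complex]])
    from diff_chain_at[OF this bounded_linear_imp_has_derivative[OF bounded_linear_complex_vec]]
    have "(g has_derivative g' v) (at v)" by (simp add: g_def g'_def o_assoc)
    then show ?thesis by (rule has_derivative_at_withinI)
  qed
  have ginj: "inj_on g T"
  proof (rule inj_onI)
    fix x y assume "x \<in> T" "y \<in> T" "g x = g y"
    then have "F (vec_complex x) = F (vec_complex y)"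
      by (metis g_def comp_apply vec_complex_inverse)
    then have "vec_complex x = vec_complex y" using inj \<open>x \<in> T\<close> \<open>y \<in> T\<close> by (auto simp: T_def inj_on_def)
    then show "x = y" by (metis complex_vec_inverse)
  qed
  have gsub: "g ` T \<subseteq> ball (complex_vec w) R"
  proof
    fix p assume "p \<in> g ` T"
    then obtain v where v: "v \<in> T" "p = g v" by auto
    have "dist (complex_vec w) p = norm (w - F (vec_complex v))"
      using v norm_complex_vec[of "w - F (vec_complex v)"]
      by (simp add: dist_norm g_def linear_diff[OF bounded_linear.linear[OF bounded_linear_complex_vec]])
    also have "\<dots> < R" using sub v by (auto simp: T_def dist_norm)
    finally show "p \<in> ball (complex_vec w) R" by simp
  qed
  have "g ` T \<in> sets lebesgue"
    by (rule differentiable_image_in_sets_lebesgue[OF TL]) (use dg in \<open>auto simp: differentiable_on_def differentiable_def\<close>)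
  then have lm: "g ` T \<in> lmeasurable"
    by (rule bounded_set_imp_lmeasurable[rotated]) (use gsub bounded_ball bounded_subset in blast)
  then have hi: "((\<lambda>v. \<bar>det (matrix (g' v))\<bar>) has_integral measure lebesgue (g ` T)) T"
    using has_measure_differentiable_image[OF TL dg ginj] by blast
  have det: "det (matrix (g' v)) = real_Jacobian (F' (vec_complex v))" for v
  proof -
    have "vec_complex (axis 1 1) = 1" "vec_complex (axis 2 1) = \<i>"
      by (auto simp: vec_complex_def complex_eq_iff axis_def)
    then show ?thesis
      by (simp add: det_2 matrix_def g'_def real_Jacobian_def complex_vec_def)
  qed
  have "measure lebesgue (g ` T) \<le> measure lebesgue (ball (complex_vec w) R)"
    by (rule measure_mono_fmeasurable[OF gsub]) (use lm in \<open>auto simp: fmeasurableD\<close>)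
  also have "\<dots> = pi * R\<^sup>2"
    using R by (simp add: content_ball unit_ball_vol_2)
  finally have le: "measure lebesgue (g ` T) \<le> pi * R\<^sup>2" .
  have m2: "(\<lambda>v. indicator T v * \<bar>real_Jacobian (F' (vec_complex v))\<bar>) \<in> borel_measurable borel"
    using measurable_compose[OF m meas] by (simp add: T_def indicator_def)
  have "((\<lambda>v. if v \<in> T then \<bar>real_Jacobian (F' (vec_complex v))\<bar> else 0) has_integral measure lebesgue (g ` T)) UNIV"
    using hi by (simp add: det has_integral_restrict_UNIV)
  then have hi2: "((\<lambda>v. indicator T v * \<bar>real_Jacobian (F' (vec_complex v))\<bar>) has_integral measure lebesgue (g ` T)) UNIV"
    by (rule has_integral_eq[rotated]) (auto simp: indicator_def)
  have "(\<integral>\<^sup>+z. ennreal (indicator S z * \<bar>real_Jacobian (F' z)\<bar>) \<partial>lborel)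
     = (\<integral>\<^sup>+v. ennreal (indicator T v * \<bar>real_Jacobian (F' (vec_complex v))\<bar>) \<partial>lborel)"
    by (subst distr_lborel_vec_complex[symmetric], subst nn_integral_distr)
      (use m meas in \<open>auto simp: T_def indicator_def\<close>)
  also have "\<dots> = ennreal (measure lebesgue (g ` T))"
    using m2 hi2 by (intro nn_integral_has_integral_lborel) auto
  finally show ?thesis using le by (simp add: ennreal_leI)
qed

section \<open>The length-area estimate\<close>

text \<open>Take for p the last point where u is at most s, and for q the first point after p where
  u is at least t; both exist by compactness.\<close>

lemma interval_crossing_ordered:
  fixes u :: "real \<Rightarrow> real"
  assumes "\<alpha> \<le> \<beta>" and cont: "continuous_on {\<alpha>..\<beta>} u" and "u \<alpha> \<le> s" "s < t" "t \<le> u \<beta>"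
  obtains p q where "p < q" "{p..q} \<subseteq> {\<alpha>..\<beta>}" "u p \<le> s" "t \<le> u q" "\<And>y. p < y \<Longrightarrow> y < q \<Longrightarrow> s < u y \<and> u y < t"
proof -
  have "compact {y\<in>{\<alpha>..\<beta>}. u y \<le> s}"
    by (rule closed_Int_compact[of _ "{\<alpha>..\<beta>}", THEN back_subst[of compact]])
       (use continuous_on_closed_Collect_le[OF cont continuous_on_const[of _ s]] in auto)
  moreover have "{y\<in>{\<alpha>..\<beta>}. u y \<le> s} \<noteq> {}" using assms by auto
  ultimately obtain p where p: "p \<in> {y\<in>{\<alpha>..\<beta>}. u y \<le> s}" "\<And>y. y \<in> {y\<in>{\<alpha>..\<beta>}. u y \<le> s} \<Longrightarrow> y \<le> p"
    by (meson compact_attains_sup)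
  have cont': "continuous_on {p..\<beta>} u"
    by (rule continuous_on_subset[OF cont]) (use p in auto)
  have "compact {y\<in>{p..\<beta>}. t \<le> u y}"
    by (rule closed_Int_compact[of _ "{p..\<beta>}", THEN back_subst[of compact]])
       (use continuous_on_closed_Collect_le[OF continuous_on_const[of _ t] cont'] in auto)
  moreover have "{y\<in>{p..\<beta>}. t \<le> u y} \<noteq> {}" using assms p by auto
  ultimately obtain q where q: "q \<in> {y\<in>{p..\<beta>}. t \<le> u y}" "\<And>y. y \<in> {y\<in>{p..\<beta>}. t \<le> u y} \<Longrightarrow> q \<le> y"
    by (meson compact_attains_inf)
  have "p \<noteq> q" using p q assms by auto
  show ?thesis
  proof
    show "p < q" using q \<open>p \<noteq> q\<close> by auto
    show "{p..q} \<subseteq> {\<alpha>..\<beta>}" using p q by auto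
    show "u p \<le> s" "t \<le> u q" using p q by auto
    fix y assume y: "p < y" "y < q"
    have "y \<in> {\<alpha>..\<beta>}" "y \<in> {p..\<beta>}" using p(1) q(1) y by auto
    then show "s < u y \<and> u y < t" using p(2)[of y] q(2)[of y] y by (auto simp: not_le[symmetric])
  qed
qed

text \<open>The low endpoint may lie on either side of the high one. For \<alpha> > \<beta> the
  ordered case is applied after the reflection y \<mapsto> -y; this exchanges p and q, so only the
  absolute difference of the values is recorded.\<close>

lemma interval_crossing:
  fixes u :: "real \<Rightarrow> real"
  assumes cont: "continuous_on (closed_segment \<alpha> \<beta>) u" and "u \<alpha> \<le> s" "s < t" "t \<le> u \<beta>"
  obtains p q where "p < q" "{p..q} \<subseteq> closed_segment \<alpha> \<beta>" "t - s \<le> \<bar>u q - u p\<bar>"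
    "\<And>y. p < y \<Longrightarrow> y < q \<Longrightarrow> s < u y \<and> u y < t"
proof (cases "\<alpha> \<le> \<beta>")
  case True
  then have seg: "closed_segment \<alpha> \<beta> = {\<alpha>..\<beta>}" by (simp add: closed_segment_eq_real_ivl)
  obtain p q where pq: "p < q" "{p..q} \<subseteq> {\<alpha>..\<beta>}" "u p \<le> s" "t \<le> u q"
    "\<And>y. p < y \<Longrightarrow> y < q \<Longrightarrow> s < u y \<and> u y < t"
    using interval_crossing_ordered[of \<alpha> \<beta> u s t] True assms seg by auto
  show ?thesis
    by (rule that[of p q]) (use pq seg in auto)
next
  case False
  have c: "continuous_on {-\<alpha>..-\<beta>} (u \<circ> uminus)"
    by (intro continuous_on_compose continuous_intros continuous_on_subset[OF cont])
      (use False in \<open>auto simp: closed_segment_eq_real_ivl\<close>)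
  obtain p q where pq: "p < q" "{p..q} \<subseteq> {-\<alpha>..-\<beta>}" "u (-p) \<le> s" "t \<le> u (-q)"
    "\<And>y. p < y \<Longrightarrow> y < q \<Longrightarrow> s < u (-y) \<and> u (-y) < t"
    using interval_crossing_ordered[of "-\<alpha>" "-\<beta>" "u \<circ> uminus" s t] c False assms by auto
  show ?thesis
  proof (rule that[of "-q" "-p"])
    show "{-q..-p} \<subseteq> closed_segment \<alpha> \<beta>"
      using pq(1,2) False by (auto simp: closed_segment_eq_real_ivl)
    fix y assume "-q < y" "y < -p"
    then show "s < u y \<and> u y < t" using pq(5)[of "-y"] by auto
  qed (use pq in auto)
qed

text \<open>Some subarc runs inside the shell from radius s to radius 2 s, so its endpoints are at
  least s apart, and this displacement is at most the integral of the speed bound D.\<close>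

lemma shell_crossing_length:
  fixes \<gamma> :: "real \<Rightarrow> complex"
  assumes der: "\<And>y. y \<in> closed_segment \<alpha> \<beta> \<Longrightarrow> (\<gamma> has_vector_derivative \<gamma>' y) (at y)"
    and cont: "continuous_on (closed_segment \<alpha> \<beta>) D"
    and D: "\<And>y. y \<in> closed_segment \<alpha> \<beta> \<Longrightarrow> norm (\<gamma>' y) \<le> D y"
    and s: "0 < s" "norm (\<gamma> \<alpha> - w) \<le> s" "2 * s \<le> norm (\<gamma> \<beta> - w)"
  shows "ennreal s \<le> (\<integral>\<^sup>+y. ennreal (indicator {y \<in> closed_segment \<alpha> \<beta>. s < norm (\<gamma> y - w) \<and> norm (\<gamma> y - w) < 2 * s} y * D y) \<partial>lborel)"
proof -
  let ?A = "{y \<in> closed_segment \<alpha> \<beta>. s < norm (\<gamma> y - w) \<and> norm (\<gamma> y - w) < 2 * s}"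
  have c\<gamma>: "continuous_on (closed_segment \<alpha> \<beta>) \<gamma>"
    by (rule continuous_at_imp_continuous_on) (use der has_vector_derivative_continuous in blast)
  obtain p q where pq: "p < q" "{p..q} \<subseteq> closed_segment \<alpha> \<beta>" "2 * s - s \<le> \<bar>norm (\<gamma> q - w) - norm (\<gamma> p - w)\<bar>"
     "\<And>y. p < y \<Longrightarrow> y < q \<Longrightarrow> s < norm (\<gamma> y - w) \<and> norm (\<gamma> y - w) < 2 * s"
    by (rule interval_crossing[of \<alpha> \<beta> "\<lambda>y. norm (\<gamma> y - w)" s "2 * s"])
      (use s in \<open>auto intro!: continuous_intros c\<gamma>\<close>)
  have cD: "continuous_on {p..q} D" by (rule continuous_on_subset[OF cont pq(2)])
  have hi: "(\<gamma>' has_integral (\<gamma> q - \<gamma> p)) {p..q}"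
    by (rule fundamental_theorem_of_calculus) (use pq(1,2) in \<open>auto intro!: has_vector_derivative_at_within der\<close>)
  have Di: "D integrable_on {p..q}" using cD by (simp add: integrable_continuous_interval)
  have "s \<le> norm (\<gamma> q - \<gamma> p)"
    using pq(3) norm_triangle_ineq3[of "\<gamma> q - w" "\<gamma> p - w"] by simp
  also have "\<gamma> q - \<gamma> p = integral {p..q} \<gamma>'" using hi by (simp add: integral_unique)
  also have "norm (integral {p..q} \<gamma>') \<le> integral {p..q} D"
    using hi Di D pq(2) by (intro integral_norm_bound_integral) auto
  finally have le: "s \<le> integral {p..q} D" .
  have D0: "0 \<le> D y" if "y \<in> {p..q}" for y by (rule order_trans[OF norm_ge_zero D]) (use pq(2) that in blast)
  \<comment> \<open>The open interval is used because the endpoints p and q need not satisfy the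
    strict shell inequalities.\<close>
  have hi2: "(D has_integral (integral {p..q} D)) {p<..<q}"
    using Di has_integral_Icc_iff_Ioo by (metis integrable_integral)
  have "ennreal s \<le> ennreal (integral {p..q} D)" using le by (simp add: ennreal_leI)
  also have "\<dots> = (\<integral>\<^sup>+y. ennreal (indicator {p<..<q} y * D y) \<partial>lborel)"
    by (rule nn_integral_has_integral_lebesgue[OF _ hi2, symmetric]) (use D0 in auto)
  also have "\<dots> \<le> (\<integral>\<^sup>+y. ennreal (indicator ?A y * D y) \<partial>lborel)"
  proof (rule nn_integral_mono, rule ennreal_leI)
    fix y
    show "indicator {p<..<q} y * D y \<le> indicator ?A y * D y"
    proof (cases "y \<in> {p<..<q}")
      case True
      then have "y \<in> ?A" using pq(2,4) by auto
      then show ?thesis using True by simp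
    next
      case False
      have "0 \<le> indicator ?A y * D y"
        using order_trans[OF norm_ge_zero D[of y]] by (auto simp: indicator_def)
      then show ?thesis using False by simp
    qed
  qed
  finally show ?thesis .
qed

text \<open>
  Length-area estimate for the metric |dw| / |w - w0|, discretised to the weights 1 / s j on
  the dyadic shells s j < |w - w0| < 2 s j. The change of variables bounds the weighted area
  in each shell by 4 pi K, however many of the shells are used.
\<close>

lemma length_area:
  fixes H G :: "complex \<Rightarrow> complex" and n :: nat
  defines "F \<equiv> \<lambda>z. H z + cnj (G z)"
  assumes U: "open U" and hol: "H holomorphic_on U" "G holomorphic_on U"
    and S: "S \<in> sets borel" "S \<subseteq> U" and inj: "inj_on F S"
    and qc: "\<And>z. z \<in> S \<Longrightarrow> (norm (deriv H z) + norm (deriv G z))\<^sup>2 \<le> K * \<bar>(norm (deriv H z))\<^sup>2 - (norm (deriv G z))\<^sup>2\<bar>"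
    and K: "0 \<le> K"
    and strip: "\<And>z. z \<in> S \<Longrightarrow> y0 \<le> Im z \<and> Im z \<le> y0 + l" and l: "0 < l"
    and n: "0 < n" and a: "0 < a" and x: "x0 < x1"
    and cross: "\<And>x. x0 < x \<Longrightarrow> x < x1 \<Longrightarrow> \<exists>\<alpha> \<beta>. (\<forall>y\<in>closed_segment \<alpha> \<beta>. Complex x y \<in> S) \<and>
        norm (F (Complex x \<alpha>) - w) \<le> a \<and> 2 ^ n * a \<le> norm (F (Complex x \<beta>) - w)"
  shows "real n * (x1 - x0) \<le> 4 * pi * K * l"
proof -
  define D where "D z = norm (deriv H z) + norm (deriv G z)" for z
  define s where "s j = 2 ^ j * a" for j :: nat
  define A where "A j = {z\<in>S. s j < norm (F z - w) \<and> norm (F z - w) < 2 * s j}" for j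
  \<comment> \<open>The AM-GM parameter is balanced: its linear term integrates to at most \<mu> l /
    2 = n / 2 over a slice, half of the total weighted length n, so at least n / 2 is left for the
    quadratic term \<open>Q\<close>.\<close>
  define \<mu> where "\<mu> = real n / l"
  define Q where "Q z = (\<Sum>j<n. ennreal (indicator (A j) z * ((D z)\<^sup>2 / (2 * \<mu> * (s j)\<^sup>2))))" for z
  have s: "0 < s j" for j using a by (simp add: s_def)
  have \<mu>: "0 < \<mu>" using n l by (simp add: \<mu>_def)
  have D0: "0 \<le> D z" for z by (simp add: D_def)
  have cF: "continuous_on U F" unfolding F_def
    by (intro continuous_intros holomorphic_on_imp_continuous_on hol)
  have cD: "continuous_on U D" unfolding D_def
    by (intro continuous_intros holomorphic_on_imp_continuous_on holomorphic_deriv hol U)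
  have dF: "(F has_derivative (\<lambda>v. deriv H z * v + cnj (deriv G z * v))) (at z)" if "z \<in> U" for z
  proof -
    have "(H has_field_derivative deriv H z) (at z)" "(G has_field_derivative deriv G z) (at z)"
      using hol U that by (auto intro: holomorphic_derivI)
    then show ?thesis unfolding F_def has_field_derivative_def
      by (intro has_derivative_add has_derivative_cnj) auto
  qed
  have jac: "real_Jacobian (\<lambda>v. deriv H z * v + cnj (deriv G z * v)) = (norm (deriv H z))\<^sup>2 - (norm (deriv G z))\<^sup>2" for z
    unfolding real_Jacobian_def cmod_power2 by (simp add: algebra_simps power2_eq_square)
  have Aborel: "A j \<in> sets borel" for j
  proof -
    have "open {z \<in> U. s j < norm (F z - w) \<and> norm (F z - w) < 2 * s j}"
    proof -
      have "{z \<in> U. s j < norm (F z - w) \<and> norm (F z - w) < 2 * s j} = U \<inter> (\<lambda>z. norm (F z - w)) -` {s j<..<2 * s j}" by auto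
      also have "open \<dots>" by (rule continuous_open_preimage) (auto intro!: continuous_intros cF U)
      finally show ?thesis .
    qed
    moreover have "A j = S \<inter> {z \<in> U. s j < norm (F z - w) \<and> norm (F z - w) < 2 * s j}"
      using S by (auto simp: A_def)
    ultimately show ?thesis using S by auto
  qed
  have AU: "A j \<subseteq> U" for j using S by (auto simp: A_def)
  have Am: "(\<lambda>z. indicator (A j) z * g z) \<in> borel_measurable borel" if "continuous_on U g" for g :: "complex \<Rightarrow> real" and j
    using borel_measurable_continuous_on_indicator[OF Aborel continuous_on_subset[OF that AU]] by simp
  have Qm: "(\<lambda>z. indicator (A j) z * ((D z)\<^sup>2 / (2 * \<mu> * (s j)\<^sup>2))) \<in> borel_measurable borel" for j
    by (rule Am) (intro continuous_intros cD, use s[of j] \<mu> in simp)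
  have Q1m: "(\<lambda>z. indicator (A j) z * (D z / s j)) \<in> borel_measurable borel" for j
    by (rule Am) (intro continuous_intros cD, use s[of j] in simp)
  \<comment> \<open>Shells with different indices are disjoint because 2 s i \<le> s j for i < j.
    The linear AM-GM term is therefore counted once and not n times.\<close>
  have disj: "(\<Sum>j<n. indicator (A j) z * (1::real)) \<le> indicator S z" for z
  proof (cases "\<exists>j<n. z \<in> A j")
    case True
    then obtain j where j: "j < n" "z \<in> A j" by blast
    have "z \<notin> A i" if "i \<noteq> j" for i
    proof
      assume i: "z \<in> A i"
      consider "i < j" | "j < i" using \<open>i \<noteq> j\<close> by linarith
      then show False
      proof cases
        case 1
        then have "(2::real) ^ Suc i \<le> 2 ^ j" by (intro power_increasing) auto
        then have "2 * s i \<le> s j" using mult_right_mono[of "2 ^ Suc i" "2 ^ j" a] a by (simp add: s_def)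
        then show False using i j by (auto simp: A_def)
      next
        case 2
        then have "(2::real) ^ Suc j \<le> 2 ^ i" by (intro power_increasing) auto
        then have "2 * s j \<le> s i" using mult_right_mono[of "2 ^ Suc j" "2 ^ i" a] a by (simp add: s_def)
        then show False using i j by (auto simp: A_def)
      qed
    qed
    then have "(\<Sum>i<n. indicator (A i) z * (1::real)) = (\<Sum>i<n. if i = j then 1 else 0)"
      using j by (intro sum.cong) (auto simp: indicator_def)
    also have "\<dots> = 1" using j by simp
    finally show ?thesis using j by (auto simp: A_def)
  next
    case False
    then have "(\<Sum>j<n. indicator (A j) z * (1::real)) = 0" by (intro sum.neutral) auto
    then show ?thesis by simp
  qed
  have slice: "ennreal (real n / 2) \<le> (\<integral>\<^sup>+y. Q (Complex x y) \<partial>lborel)" if xx: "x0 < x" "x < x1" for x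
  proof -
    obtain \<alpha> \<beta> where ab: "\<And>y. y\<in>closed_segment \<alpha> \<beta> \<Longrightarrow> Complex x y \<in> S"
        "norm (F (Complex x \<alpha>) - w) \<le> a" "2 ^ n * a \<le> norm (F (Complex x \<beta>) - w)"
      using cross[OF xx] by blast
    have cC: "continuous_on X (\<lambda>y. Complex x y)" for X
      unfolding Complex_eq by (intro continuous_intros)
    \<comment> \<open>Crossing shell j costs length at least s j, hence at least 1 in the weight 1 /
      s j; this is what makes the weighted length grow with n.\<close>
    have one: "1 \<le> (\<integral>\<^sup>+y. ennreal (indicator (A j) (Complex x y) * (D (Complex x y) / s j)) \<partial>lborel)" if j: "j < n" for j
    proof -
      have der: "((\<lambda>y. F (Complex x y)) has_vector_derivative (deriv H (Complex x y) * \<i> + cnj (deriv G (Complex x y) * \<i>))) (at y)"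
        if "y \<in> closed_segment \<alpha> \<beta>" for y
      proof -
        have "((\<lambda>y. Complex x y) has_derivative (\<lambda>h. h *\<^sub>R \<i>)) (at y)"
          unfolding Complex_eq by (auto intro!: derivative_eq_intros simp: scaleR_conv_of_real)
        from diff_chain_at[OF this dF[of "Complex x y"]] ab(1)[OF that] S
        show ?thesis by (simp add: has_vector_derivative_def o_def scaleR_conv_of_real algebra_simps subset_iff)
      qed
      have "s j \<ge> a" using a by (simp add: s_def)
      moreover have "2 * s j \<le> 2 ^ n * a"
      proof -
        have "(2::real) ^ Suc j \<le> 2 ^ n" using j by (intro power_increasing) auto
        then show ?thesis using a by (simp add: s_def)
      qed
      ultimately have "ennreal (s j) \<le> (\<integral>\<^sup>+y. ennreal (indicator {y \<in> closed_segment \<alpha> \<beta>. s j < norm (F (Complex x y) - w) \<and> norm (F (Complex x y) - w) < 2 * s j} y * D (Complex x y)) \<partial>lborel)"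
        using ab(2,3) s
        by (intro shell_crossing_length[OF der] continuous_on_compose2[OF cD] cC)
          (auto simp: D_def norm_mult intro!: order_trans[OF norm_triangle_ineq4] dest!: ab(1) subsetD[OF S(2)])
      also have "\<dots> \<le> (\<integral>\<^sup>+y. ennreal (s j) * ennreal (indicator (A j) (Complex x y) * (D (Complex x y) / s j)) \<partial>lborel)"
      proof (rule nn_integral_mono)
        fix y
        let ?B = "{y \<in> closed_segment \<alpha> \<beta>. s j < norm (F (Complex x y) - w) \<and> norm (F (Complex x y) - w) < 2 * s j}"
        have "indicator ?B y \<le> (indicator (A j) (Complex x y) :: real)"
          using ab(1) by (auto simp: A_def indicator_def)
        then have "indicator ?B y * D (Complex x y) \<le> indicator (A j) (Complex x y) * D (Complex x y)"
          by (rule mult_right_mono) (rule D0)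
        also have "\<dots> = s j * (indicator (A j) (Complex x y) * (D (Complex x y) / s j))"
          using s[of j] by simp
        finally show "ennreal (indicator ?B y * D (Complex x y)) \<le> ennreal (s j) * ennreal (indicator (A j) (Complex x y) * (D (Complex x y) / s j))"
          using s[of j] by (subst ennreal_mult'[symmetric]) (auto intro: ennreal_leI)
      qed
      also have "\<dots> = ennreal (s j) * (\<integral>\<^sup>+y. ennreal (indicator (A j) (Complex x y) * (D (Complex x y) / s j)) \<partial>lborel)"
      proof (rule nn_integral_cmult)
        have "(\<lambda>y. Complex x y) \<in> borel_measurable borel" by (intro borel_measurable_continuous_onI cC)
        then have "(\<lambda>y. indicator (A j) (Complex x y) * (D (Complex x y) / s j)) \<in> borel_measurable borel"
          by (rule measurable_compose[OF _ Q1m])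
        then show "(\<lambda>y. ennreal (indicator (A j) (Complex x y) * (D (Complex x y) / s j))) \<in> borel_measurable lborel"
          by simp
      qed
      finally have "ennreal (s j) * 1 \<le> ennreal (s j) * (\<integral>\<^sup>+y. ennreal (indicator (A j) (Complex x y) * (D (Complex x y) / s j)) \<partial>lborel)" by simp
      then show ?thesis using s[of j] by (subst (asm) ennreal_mult_le_mult_iff) auto
    qed
    have mC: "(\<lambda>y. Complex x y) \<in> borel_measurable borel" by (intro borel_measurable_continuous_onI cC)
    have m1: "(\<lambda>y. ennreal (indicator (A j) (Complex x y) * (D (Complex x y) / s j))) \<in> borel_measurable borel" for j
      using measurable_compose[OF mC Q1m] by measurable
    have mQ: "(\<lambda>y. Q (Complex x y)) \<in> borel_measurable borel" unfolding Q_def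
      using measurable_compose[OF mC Qm] by measurable
    have "ennreal (real n) = (\<Sum>j<n. 1)" by (simp add: ennreal_of_nat_eq_real_of_nat)
    also have "\<dots> \<le> (\<Sum>j<n. \<integral>\<^sup>+y. ennreal (indicator (A j) (Complex x y) * (D (Complex x y) / s j)) \<partial>lborel)"
      by (intro sum_mono one) auto
    also have "\<dots> = (\<integral>\<^sup>+y. (\<Sum>j<n. ennreal (indicator (A j) (Complex x y) * (D (Complex x y) / s j))) \<partial>lborel)"
      by (subst nn_integral_sum) (use m1 in auto)
    also have "\<dots> \<le> (\<integral>\<^sup>+y. ennreal (\<mu> / 2) * indicator {y0..y0 + l} y + Q (Complex x y) \<partial>lborel)"
    proof (rule nn_integral_mono)
      fix y
      let ?z = "Complex x y"
      have "(\<Sum>j<n. indicator (A j) ?z * (D ?z / s j)) \<le> (\<Sum>j<n. \<mu> / 2 * (indicator (A j) ?z * 1) + indicator (A j) ?z * ((D ?z)\<^sup>2 / (2 * \<mu> * (s j)\<^sup>2)))"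
      proof (rule sum_mono)
        fix j
        \<comment> \<open>AM-GM, in place of the Cauchy-Schwarz inequality on the slice\<close>
        have "0 \<le> (\<mu> - D ?z / s j)\<^sup>2 / (2 * \<mu>)" using \<mu> by simp
        also have "\<dots> = \<mu> / 2 - D ?z / s j + (D ?z)\<^sup>2 / (2 * \<mu> * (s j)\<^sup>2)"
          using \<mu> s[of j] by (simp add: field_simps power2_eq_square)
        finally show "indicator (A j) ?z * (D ?z / s j) \<le> \<mu> / 2 * (indicator (A j) ?z * 1) + indicator (A j) ?z * ((D ?z)\<^sup>2 / (2 * \<mu> * (s j)\<^sup>2))"
          by (auto simp: indicator_def)
      qed
      also have "\<dots> = \<mu> / 2 * (\<Sum>j<n. indicator (A j) ?z * 1) + (\<Sum>j<n. indicator (A j) ?z * ((D ?z)\<^sup>2 / (2 * \<mu> * (s j)\<^sup>2)))"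
        by (simp add: sum.distrib sum_distrib_left)
      also have "\<dots> \<le> \<mu> / 2 * indicator S ?z + (\<Sum>j<n. indicator (A j) ?z * ((D ?z)\<^sup>2 / (2 * \<mu> * (s j)\<^sup>2)))"
        using disj[of ?z] \<mu> by (intro add_right_mono mult_left_mono) auto
      also have "\<dots> \<le> \<mu> / 2 * indicator {y0..y0 + l} y + (\<Sum>j<n. indicator (A j) ?z * ((D ?z)\<^sup>2 / (2 * \<mu> * (s j)\<^sup>2)))"
        using strip[of ?z] \<mu> by (intro add_right_mono mult_left_mono) (auto simp: indicator_def)
      finally have "ennreal (\<Sum>j<n. indicator (A j) ?z * (D ?z / s j)) \<le> ennreal \<dots>" by (rule ennreal_leI)
      also have "\<dots> = ennreal (\<mu> / 2) * indicator {y0..y0 + l} y + Q ?z"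
        unfolding Q_def using \<mu> s
        by (subst sum_ennreal) (auto simp: ennreal_plus sum_nonneg less_imp_le indicator_def)
      finally show "(\<Sum>j<n. ennreal (indicator (A j) ?z * (D ?z / s j))) \<le> ennreal (\<mu> / 2) * indicator {y0..y0 + l} y + Q ?z"
        using D0 s by (subst sum_ennreal) (auto simp: less_imp_le)
    qed
    also have "\<dots> = ennreal (\<mu> / 2) * l + (\<integral>\<^sup>+y. Q (Complex x y) \<partial>lborel)"
      using mQ l by (subst nn_integral_add) (auto simp: nn_integral_cmult)
    also have "ennreal (\<mu> / 2) * l = ennreal (real n / 2)"
      using l n by (subst ennreal_mult''[symmetric]) (simp_all add: \<mu>_def)
    finally have "ennreal (real n / 2) + ennreal (real n / 2) \<le> ennreal (real n / 2) + (\<integral>\<^sup>+y. Q (Complex x y) \<partial>lborel)"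
      by (subst ennreal_plus[symmetric]) (auto simp del: ennreal_plus)
    then show ?thesis by (simp add: ennreal_add_left_cancel_le)
  qed
  have mQ: "Q \<in> borel_measurable borel" unfolding Q_def
    using Qm by measurable
  have "ennreal (real n / 2 * (x1 - x0)) = (\<integral>\<^sup>+x. ennreal (real n / 2) * indicator {x0<..<x1} x \<partial>lborel)"
    using x by (subst ennreal_mult'') (auto simp: nn_integral_cmult)
  also have "\<dots> \<le> (\<integral>\<^sup>+x. \<integral>\<^sup>+y. Q (Complex x y) \<partial>lborel \<partial>lborel)"
  proof (rule nn_integral_mono)
    fix x
    show "ennreal (real n / 2) * indicator {x0<..<x1} x \<le> (\<integral>\<^sup>+y. Q (Complex x y) \<partial>lborel)"
      by (cases "x \<in> {x0<..<x1}") (use slice[of x] in \<open>simp_all\<close>)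
  qed
  also have "\<dots> = (\<integral>\<^sup>+z. Q z \<partial>lborel)"
    using nn_integral_complex_iterated[OF mQ] by simp
  also have "\<dots> = (\<Sum>j<n. \<integral>\<^sup>+z. ennreal (indicator (A j) z * ((D z)\<^sup>2 / (2 * \<mu> * (s j)\<^sup>2))) \<partial>lborel)"
    unfolding Q_def
    by (intro nn_integral_sum measurable_compose[OF _ measurable_ennreal]) (use Qm in simp)
  also have "\<dots> \<le> (\<Sum>j<n. ennreal (4 * pi * K * l / (2 * real n)))"
  proof (rule sum_mono)
    fix j assume "j \<in> {..<n}"
    let ?J = "\<lambda>z. \<bar>(norm (deriv H z))\<^sup>2 - (norm (deriv G z))\<^sup>2\<bar>"
    have mJ: "(\<lambda>z. indicator (A j) z * ?J z) \<in> borel_measurable borel"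
      by (intro Am continuous_intros holomorphic_on_imp_continuous_on holomorphic_deriv hol U)
    have area: "(\<integral>\<^sup>+z. ennreal (indicator (A j) z * ?J z) \<partial>lborel) \<le> ennreal (pi * (2 * s j)\<^sup>2)"
    proof -
      have "(\<integral>\<^sup>+z. ennreal (indicator (A j) z * \<bar>real_Jacobian (\<lambda>v. deriv H z * v + cnj (deriv G z * v))\<bar>) \<partial>lborel) \<le> ennreal (pi * (2 * s j)\<^sup>2)"
      proof (rule nn_integral_Jacobian_le[where F = F and w = w, OF Aborel])
        show "inj_on F (A j)" by (rule inj_on_subset[OF inj]) (auto simp: A_def)
        show "F ` A j \<subseteq> ball w (2 * s j)" by (auto simp: A_def dist_norm norm_minus_commute)
        show "0 \<le> 2 * s j" using s[of j] by simp
        show "(\<lambda>z. indicator (A j) z * \<bar>real_Jacobian (\<lambda>v. deriv H z * v + cnj (deriv G z * v))\<bar>) \<in> borel_measurable borel"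
          unfolding jac by (rule mJ)
      qed (use dF AU in auto)
      then show ?thesis unfolding jac .
    qed
    have "(\<integral>\<^sup>+z. ennreal (indicator (A j) z * ((D z)\<^sup>2 / (2 * \<mu> * (s j)\<^sup>2))) \<partial>lborel)
      \<le> (\<integral>\<^sup>+z. ennreal (K / (2 * \<mu> * (s j)\<^sup>2)) * ennreal (indicator (A j) z * ?J z) \<partial>lborel)"
    proof (rule nn_integral_mono)
      fix z
      have "indicator (A j) z * ((D z)\<^sup>2 / (2 * \<mu> * (s j)\<^sup>2)) \<le> K / (2 * \<mu> * (s j)\<^sup>2) * (indicator (A j) z * ?J z)"
      proof (cases "z \<in> A j")
        case True
        then have "(D z)\<^sup>2 \<le> K * ?J z" using qc[of z] by (simp add: A_def D_def)
        then have "(D z)\<^sup>2 / (2 * \<mu> * (s j)\<^sup>2) \<le> K * ?J z / (2 * \<mu> * (s j)\<^sup>2)"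
          by (rule divide_right_mono) (use \<mu> in simp)
        then show ?thesis using True by simp
      qed simp
      then show "ennreal (indicator (A j) z * ((D z)\<^sup>2 / (2 * \<mu> * (s j)\<^sup>2))) \<le> ennreal (K / (2 * \<mu> * (s j)\<^sup>2)) * ennreal (indicator (A j) z * ?J z)"
        using K \<mu> by (subst ennreal_mult'[symmetric]) (auto intro: ennreal_leI)
    qed
    also have "\<dots> = ennreal (K / (2 * \<mu> * (s j)\<^sup>2)) * (\<integral>\<^sup>+z. ennreal (indicator (A j) z * ?J z) \<partial>lborel)"
      using mJ by (intro nn_integral_cmult) auto
    also have "\<dots> \<le> ennreal (K / (2 * \<mu> * (s j)\<^sup>2)) * ennreal (pi * (2 * s j)\<^sup>2)"
      by (rule mult_left_mono[OF area]) simp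
    also have "\<dots> = ennreal (4 * pi * K * l / (2 * real n))"
    proof -
      \<comment> \<open>The area 4 pi (s j)^2 of the disk containing the image of \<open>A j\<close>
        cancels the weight 1 / (s j)^2, so every shell contributes the same amount 2 pi K / \<mu>;
        the factor 1 / n in 1 / \<mu> then cancels in the sum over the shells.\<close>
      have "K / (2 * \<mu> * (s j)\<^sup>2) * (pi * (2 * s j)\<^sup>2) = 4 * pi * K * l / (2 * real n)"
        using s[of j] n l by (simp add: \<mu>_def field_simps power2_eq_square)
      then show ?thesis by (subst ennreal_mult''[symmetric]) simp_all
    qed
    finally show "(\<integral>\<^sup>+z. ennreal (indicator (A j) z * ((D z)\<^sup>2 / (2 * \<mu> * (s j)\<^sup>2))) \<partial>lborel) \<le> ennreal (4 * pi * K * l / (2 * real n))" .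
  qed
  also have "\<dots> = ennreal (\<Sum>j<n. 4 * pi * K * l / (2 * real n))"
    by (rule sum_ennreal) (use K l in simp)
  also have "(\<Sum>j<n. 4 * pi * K * l / (2 * real n)) = 2 * pi * K * l" using n by simp
  finally have "ennreal (real n / 2 * (x1 - x0)) \<le> ennreal (2 * pi * K * l)" .
  moreover have "0 \<le> 2 * pi * K * l" using K l by simp
  ultimately have "real n / 2 * (x1 - x0) \<le> 2 * pi * K * l"
    using ennreal_le_iff by blast
  then show ?thesis by (simp add: mult.commute mult.left_commute)
qed

section \<open>Quasiconformal harmonic maps of the disk\<close>

text \<open>A form of the Borel-Caratheodory inequality. The maximum principle carries the one-sided
  bound from the circle to the disk, and the Schwarz lemma applies to a Moebius transform of
  p.\<close>

lemma maximum_real_part_growth: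
  assumes hol: "p holomorphic_on A" and sub: "cball z t \<subseteq> A" and p0: "p z = 0"
    and M: "0 < M" "\<And>\<zeta>. dist z \<zeta> = t \<Longrightarrow> Re (p \<zeta>) \<le> M"
    and \<zeta>: "dist z \<zeta> < t"
  shows "norm (p \<zeta>) \<le> 4 * M * dist z \<zeta> / (t - dist z \<zeta>)"
proof -
  have t: "0 < t" using \<zeta> zero_le_dist[of z \<zeta>] by linarith
  have Re_le: "Re (p x) \<le> M" if "dist z x < t" for x
  proof (rule maximum_real_frontier[of p "ball z t"])
    show "p holomorphic_on interior (ball z t)"
      using holomorphic_on_subset[OF hol] sub ball_subset_cball by (metis interior_ball subset_trans)
    show "continuous_on (closure (ball z t)) p"
      using holomorphic_on_imp_continuous_on[OF holomorphic_on_subset[OF hol sub]] t by simp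
  qed (use t M that in \<open>auto simp: frontier_ball\<close>)
  \<comment> \<open>With 4 M in place of the customary 2 M the difference |4 M - p|^2 - |p|^2 = 16
    M^2 - 8 M Re p is at least 8 M^2. So |q| < 1 strictly, even where Re p = M.\<close>
  define q where "q u = p (z + t * u) / (4 * M - p (z + t * u))" for u :: complex
  have inb: "dist z (z + t * u) < t" if "norm u < 1" for u :: complex
    using that t by (simp add: dist_norm norm_mult)
  have Re_lt: "norm (p x) < norm (4 * M - p x)" "4 * M - p x \<noteq> 0" if "dist z x < t" for x
  proof -
    have "0 < 16 * M\<^sup>2 - 8 * M * Re (p x)"
      using Re_le[OF that] M by (simp add: power2_eq_square)
    then have "(norm (p x))\<^sup>2 < (norm (4 * M - p x))\<^sup>2"
      by (simp add: cmod_power2 power2_diff)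
    then show "norm (p x) < norm (4 * M - p x)" by (rule power2_less_imp_less) simp
    then show "4 * M - p x \<noteq> 0" by auto
  qed
  define u where "u = (\<zeta> - z) / t"
  have u: "z + t * u = \<zeta>" "norm u = dist z \<zeta> / t" "norm u < 1"
    using t \<zeta> by (auto simp: u_def dist_norm norm_divide norm_minus_commute)
  have "norm (q u) \<le> norm u"
  proof (rule Schwarz_Lemma(1)[of q])
    have "(\<lambda>u::complex. z + t * u) ` ball 0 1 \<subseteq> A"
      using inb sub by (auto simp: less_imp_le subset_iff)
    then show "q holomorphic_on ball 0 1"
      unfolding q_def using Re_lt(2) inb
      by (intro holomorphic_intros holomorphic_on_compose_gen[OF _ hol, unfolded o_def]) (auto simp: image_subset_iff)
    show "norm (q x) < 1" if "norm x < 1" for x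
      using Re_lt[OF inb[OF that]] by (simp add: q_def norm_divide)
  qed (use p0 u in \<open>simp_all add: q_def\<close>)
  then have "norm (p \<zeta>) / norm (4 * M - p \<zeta>) \<le> dist z \<zeta> / t" by (simp add: q_def u norm_divide)
  then have "norm (p \<zeta>) * t \<le> dist z \<zeta> * norm (4 * M - p \<zeta>)"
    using Re_lt[OF \<zeta>] t by (simp add: field_simps)
  also have "\<dots> \<le> dist z \<zeta> * (4 * M + norm (p \<zeta>))"
    using norm_triangle_ineq4[of "complex_of_real (4 * M)" "p \<zeta>"] M by (intro mult_left_mono) auto
  finally show ?thesis using \<zeta> by (simp add: field_simps)
qed

section \<open>Distance to the boundary of the image, and winding numbers\<close>

lemma ball_infdist_frontier_subset:
  fixes G :: "'a::euclidean_space set"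
  assumes "open G" "w \<in> G"
  shows "ball w (infdist w (frontier G)) \<subseteq> G"
proof (rule ccontr)
  assume "\<not> ?thesis"
  then obtain v where v: "dist w v < infdist w (frontier G)" "v \<notin> G"
    by (auto simp: subset_eq)
  then have "0 < infdist w (frontier G)" using zero_le_dist[of w v] by linarith
  then have "v \<in> ball w (infdist w (frontier G)) - G" "w \<in> ball w (infdist w (frontier G)) \<inter> G"
    using v assms(2) by auto
  then have "ball w (infdist w (frontier G)) - G \<noteq> {}" "ball w (infdist w (frontier G)) \<inter> G \<noteq> {}" by blast+
  then have "ball w (infdist w (frontier G)) \<inter> frontier G \<noteq> {}"
    by (intro connected_Int_frontier) (auto simp: Int_commute)
  then obtain b where "b \<in> frontier G" "dist w b < infdist w (frontier G)" by auto
  then show False using infdist_le[of b "frontier G" w] by linarith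
qed

lemma cball_subset_unit_disk:
  assumes "t < 1 - norm z"
  shows "cball z t \<subseteq> unit_disk"
proof
  fix v assume "v \<in> cball z t"
  then have "norm (v - z) \<le> t" by (simp add: dist_norm norm_minus_commute)
  then show "v \<in> unit_disk" using norm_triangle_sub[of v z] assms by simp
qed

text \<open>The distortion inequality is required at every point and for h' and g' directly, the
  form in which it can be composed with holomorphic maps. Boundedness of the image ensures that its
  frontier is nonempty, so that the boundary distance is positive.\<close>

locale harmonic_qc_disk =
  fixes K :: real and f h g :: "complex \<Rightarrow> complex"
  assumes K: "1 \<le> K"
    and hol: "h holomorphic_on unit_disk" "g holomorphic_on unit_disk"
    and f_eq: "\<And>z. z \<in> unit_disk \<Longrightarrow> f z = h z + cnj (g z)"
    and inj: "inj_on f unit_disk"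
    and sense: "sense_preserving_on f unit_disk"
    and bounded_image: "bounded (f ` unit_disk)"
    and dilatation: "\<And>z. z \<in> unit_disk \<Longrightarrow>
      (norm (deriv h z) + norm (deriv g z))\<^sup>2 \<le> K * \<bar>(norm (deriv h z))\<^sup>2 - (norm (deriv g z))\<^sup>2\<bar>"
begin

definition bdist :: "complex \<Rightarrow> real" where "bdist z = boundary_dist (f ` unit_disk) (f z)"

lemma continuous_on_f: "continuous_on unit_disk f"
proof -
  have "continuous_on unit_disk (\<lambda>z. h z + cnj (g z))"
    by (intro continuous_intros holomorphic_on_imp_continuous_on hol)
  then show ?thesis using f_eq by (metis (no_types, lifting) continuous_on_cong)
qed

lemma open_image: "open (f ` unit_disk)"
  by (rule invariance_of_domain[OF continuous_on_f _ inj]) simp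

lemma frontier_image_nonempty: "frontier (f ` unit_disk) \<noteq> {}"
  using bounded_image not_bounded_UNIV by (auto simp: frontier_eq_empty)

lemma frontier_image_disjoint: "frontier (f ` unit_disk) \<inter> f ` unit_disk = {}"
  using open_image by (simp add: frontier_def interior_open Diff_Int_distrib2)

lemma bdist_nonneg: "0 \<le> bdist z"
  by (simp add: bdist_def boundary_dist_def infdist_nonneg)

lemma bdist_pos: "z \<in> unit_disk \<Longrightarrow> 0 < bdist z"
  unfolding bdist_def boundary_dist_def
  using frontier_image_nonempty frontier_image_disjoint
  by (intro infdist_pos_not_in_closed) auto

lemma bdist_lipschitz: "\<bar>bdist z - bdist \<zeta>\<bar> \<le> norm (f z - f \<zeta>)"
  unfolding bdist_def boundary_dist_def
  by (metis dist_norm infdist_triangle_abs)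

lemma ball_bdist_subset: "z \<in> unit_disk \<Longrightarrow> ball (f z) (bdist z) \<subseteq> f ` unit_disk"
  unfolding bdist_def boundary_dist_def by (rule ball_infdist_frontier_subset[OF open_image]) simp

text \<open>
  Otherwise the image of the circle winds equally often around f z, namely once, and around
  a nearest boundary point, which f omits.
\<close>

lemma circle_image_meets_cball:
  assumes t: "0 < t" "cball z t \<subseteq> unit_disk"
  shows "\<exists>\<zeta>. dist z \<zeta> = t \<and> norm (f \<zeta> - f z) \<le> bdist z"
proof (rule ccontr)
  assume neg: "\<not> ?thesis"
  let ?c = "circlepath z t"
  have ctf: "continuous_on (cball z t) f" by (rule continuous_on_subset[OF continuous_on_f t(2)])
  have img: "path_image ?c = sphere z t" using t by simp
  have p: "path (f \<circ> ?c)"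
    by (rule path_continuous_image) (use img in \<open>auto intro: continuous_on_subset[OF ctf]\<close>)
  have pim: "path_image (f \<circ> ?c) = f ` sphere z t" using img by (simp add: path_image_compose)
  obtain w0 where w0: "w0 \<in> frontier (f ` unit_disk)" "dist (f z) w0 = bdist z"
    unfolding bdist_def boundary_dist_def
    by (rule infdist_attains_inf[OF frontier_closed frontier_image_nonempty, of "f z"]) simp
  have "winding_number (f \<circ> ?c) constant_on cball (f z) (bdist z)"
  proof (rule winding_number_constant[OF p])
    show "cball (f z) (bdist z) \<inter> path_image (f \<circ> ?c) = {}"
      using neg by (auto simp: pim dist_norm norm_minus_commute)
  qed (auto simp: pathfinish_compose pathstart_compose)
  moreover have "f z \<in> cball (f z) (bdist z)" "w0 \<in> cball (f z) (bdist z)"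
    using w0 by (auto simp: bdist_def boundary_dist_def infdist_nonneg)
  ultimately have eq: "winding_number (f \<circ> ?c) (f z) = winding_number (f \<circ> ?c) w0"
    unfolding constant_on_def by metis
  have one: "winding_number (f \<circ> ?c) (f z) = 1"
    using sense t unfolding sense_preserving_on_def by blast
  \<comment> \<open>The circle contracts to its centre inside the convex disk. The image of this
    homotopy stays in the image of f, which is open and so omits its frontier point
    \<open>w0\<close>.\<close>
  have "homotopic_loops (cball z t) ?c (linepath z z)"
  proof (rule homotopic_loops_linear)
    fix s :: real assume s: "s \<in> {0..1}"
    have "?c s \<in> cball z t" using img s by (metis mem_sphere mem_cball image_eqI order_refl path_image_def)
    then show "closed_segment (?c s) (linepath z z s) \<subseteq> cball z t"
      using t by (intro closed_segment_subset) (auto simp: linepath_def algebra_simps simp flip: scaleR_left_distrib)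
  qed auto
  then have "homotopic_loops (- {w0}) (f \<circ> ?c) (f \<circ> linepath z z)"
  proof (rule homotopic_loops_continuous_image[OF _ ctf])
    show "f \<in> cball z t \<rightarrow> - {w0}"
      using t w0 frontier_image_disjoint by blast
  qed
  then have "winding_number (f \<circ> ?c) w0 = winding_number (f \<circ> linepath z z) w0"
    by (rule winding_number_homotopic_loops)
  also have "f \<circ> linepath z z = linepath (f z) (f z)"
    by (auto simp: linepath_def fun_eq_iff simp flip: scaleR_left_distrib)
  also have "winding_number (linepath (f z) (f z)) w0 = 0"
  proof (rule winding_number_trivial)
    have "z \<in> unit_disk" using t centre_in_cball[of z t] by (simp only: subset_iff less_imp_le)
    then show "w0 \<noteq> f z" using bdist_pos[of z] w0 by auto
  qed
  finally have "winding_number (f \<circ> ?c) w0 = 0" .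
  then show False using eq one by (simp del: winding_number_circlepath)
qed

text \<open>By the chain rule both sides are multiplied by |k'|^2, so the distortion constant
  survives a holomorphic change of coordinates.\<close>

lemma composition_dilatation:
  assumes "open U" "k holomorphic_on U" "k \<in> U \<rightarrow> unit_disk" "\<zeta> \<in> U"
  shows "(norm (deriv (h \<circ> k) \<zeta>) + norm (deriv (g \<circ> k) \<zeta>))\<^sup>2
    \<le> K * \<bar>(norm (deriv (h \<circ> k) \<zeta>))\<^sup>2 - (norm (deriv (g \<circ> k) \<zeta>))\<^sup>2\<bar>"
proof -
  have k: "k field_differentiable at \<zeta>" "k \<zeta> \<in> unit_disk"
    using assms by (auto simp: holomorphic_on_imp_differentiable_at)
  have "deriv (h \<circ> k) \<zeta> = deriv h (k \<zeta>) * deriv k \<zeta>" "deriv (g \<circ> k) \<zeta> = deriv g (k \<zeta>) * deriv k \<zeta>"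
    using k hol by (auto intro!: deriv_chain holomorphic_on_imp_differentiable_at[of _ unit_disk])
  moreover have "(norm (deriv k \<zeta>))\<^sup>2 * (norm (deriv h (k \<zeta>)) + norm (deriv g (k \<zeta>)))\<^sup>2
      \<le> (norm (deriv k \<zeta>))\<^sup>2 * (K * \<bar>(norm (deriv h (k \<zeta>)))\<^sup>2 - (norm (deriv g (k \<zeta>)))\<^sup>2\<bar>)"
    using dilatation[OF k(2)] by (intro mult_left_mono) auto
  moreover have "\<bar>(norm (deriv h (k \<zeta>)) * norm (deriv k \<zeta>))\<^sup>2 - (norm (deriv g (k \<zeta>)) * norm (deriv k \<zeta>))\<^sup>2\<bar>
      = (norm (deriv k \<zeta>))\<^sup>2 * \<bar>(norm (deriv h (k \<zeta>)))\<^sup>2 - (norm (deriv g (k \<zeta>)))\<^sup>2\<bar>"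
    by (simp only: power_mult_distrib left_diff_distrib[symmetric] abs_mult) simp
  ultimately show ?thesis
    by (simp only: norm_mult distrib_right[symmetric] power_mult_distrib) (simp add: mult_ac)
qed

text \<open>Suppose the image of every circle with radius between R / 2 and 3 R / 4 had a point
  beyond distance 2^n d of f z. It also has a point within d, so it crosses n dyadic shells. In
  logarithmic coordinates the circles are vertical, and length-area bounds n. The lower radius
  leaves room for points within R / 4 of z; the upper one keeps the closed disks inside the unit
  disk.\<close>

lemma circle_image_bounded:
  "\<exists>n::nat. \<forall>z\<in>unit_disk. \<exists>t. (1 - norm z) / 2 < t \<and> t < 3 * (1 - norm z) / 4 \<and>
     (\<forall>\<zeta>. dist z \<zeta> = t \<longrightarrow> norm (f \<zeta> - f z) \<le> 2 ^ n * bdist z)"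
proof -
  \<comment> \<open>The strip has length 2 pi in the angle and width ln (3 R / 4) - ln (R / 2) = ln
    (3 / 2), which does not involve R; so n can be fixed before z.\<close>
  obtain n :: nat where n: "8 * pi\<^sup>2 * K < real n * ln (3 / 2)"
    using ex_less_of_nat_mult[of "ln (3/2)" "8 * pi\<^sup>2 * K"] by auto
  have n0: "0 < n"
  proof (rule ccontr)
    assume "\<not> 0 < n"
    then show False using n K by (simp add: mult_less_0_iff)
  qed
  show ?thesis
  proof (intro exI[of _ n] ballI, rule ccontr)
    fix z assume z: "z \<in> unit_disk"
    assume neg: "\<not> (\<exists>t>(1 - norm z) / 2. t < 3 * (1 - norm z) / 4 \<and>
     (\<forall>\<zeta>. dist z \<zeta> = t \<longrightarrow> norm (f \<zeta> - f z) \<le> 2 ^ n * bdist z))"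
    define R where "R = 1 - norm z"
    have R: "0 < R" using z by (simp add: R_def)
    define k where "k \<zeta> = z + exp \<zeta>" for \<zeta>
    define U where "U = k -` unit_disk"
    \<comment> \<open>Half-open in the imaginary part: exp is injective there, and it is the range
      of \<open>Arg2pi\<close>, so every point of the annulus has a preimage.\<close>
    define S where "S = {\<zeta>. ln (R / 2) < Re \<zeta> \<and> Re \<zeta> < ln (3 * R / 4) \<and> 0 \<le> Im \<zeta> \<and> Im \<zeta> < 2 * pi}"
    have kU: "open U" unfolding U_def k_def
      by (intro open_vimage continuous_intros) auto
    have kh: "k holomorphic_on U" unfolding k_def by (intro holomorphic_intros)
    have kr: "k \<in> U \<rightarrow> unit_disk" by (auto simp: U_def)
    have Rexp: "R / 2 < exp x \<and> exp x < 3 * R / 4 \<longleftrightarrow> ln (R / 2) < x \<and> x < ln (3 * R / 4)" for x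
      using R ln_less_cancel_iff[of "R / 2" "exp x"] ln_less_cancel_iff[of "exp x" "3 * R / 4"] by simp
    have norm_lt: "norm (k \<zeta>) < 1" if "\<zeta> \<in> S" for \<zeta>
    proof -
      have "norm (k \<zeta>) \<le> norm z + exp (Re \<zeta>)" unfolding k_def by (metis norm_exp_eq_Re norm_triangle_ineq)
      moreover have "exp (Re \<zeta>) < 3 * R / 4" using Rexp[of "Re \<zeta>"] that by (auto simp: S_def)
      ultimately show ?thesis using R by (simp add: R_def)
    qed
    then have SU: "S \<subseteq> U" by (auto simp: U_def)
    have Sb: "S \<in> sets borel" unfolding S_def by measurable
    have injk: "inj_on k S"
    proof (rule inj_onI)
      fix a b assume ab: "a \<in> S" "b \<in> S" "k a = k b"
      then have "exp a = exp b" by (simp add: k_def)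
      then obtain m :: int where m: "a = b + (of_int (2 * m) * pi) * \<i>" by (auto simp: exp_eq)
      then have "Im a = Im b + 2 * m * pi" by simp
      then have "\<bar>2 * m * pi\<bar> < 2 * pi" using ab by (auto simp: S_def)
      then have "\<bar>real_of_int m\<bar> < 1" by (simp add: abs_mult)
      then have "m = 0" by linarith
      then show "a = b" using m by simp
    qed
    have Feq: "(h \<circ> k) \<zeta> + cnj ((g \<circ> k) \<zeta>) = f (k \<zeta>)" if "\<zeta> \<in> U" for \<zeta>
      using f_eq[of "k \<zeta>"] that by (simp add: U_def)
    have "real n * (ln (3 * R / 4) - ln (R / 2)) \<le> 4 * pi * K * (2 * pi)"
    proof (rule length_area[where H = "h \<circ> k" and G = "g \<circ> k" and U = U and S = S and w = "f z" and a = "bdist z" and ?y0.0 = 0])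
      show "open U" by (rule kU)
      show "h \<circ> k holomorphic_on U" "g \<circ> k holomorphic_on U"
        using kr hol by (auto intro!: holomorphic_on_compose_gen[OF kh])
      show "inj_on (\<lambda>z. (h \<circ> k) z + cnj ((g \<circ> k) z)) S"
      proof (rule inj_onI)
        fix a b assume ab: "a \<in> S" "b \<in> S" "(h \<circ> k) a + cnj ((g \<circ> k) a) = (h \<circ> k) b + cnj ((g \<circ> k) b)"
        then have "f (k a) = f (k b)" using Feq SU by (metis subsetD)
        then have "k a = k b" using inj ab norm_lt by (auto simp: inj_on_def)
        then show "a = b" using injk ab by (auto simp: inj_on_def)
      qed
      show "(norm (deriv (h \<circ> k) \<zeta>) + norm (deriv (g \<circ> k) \<zeta>))\<^sup>2
          \<le> K * \<bar>(norm (deriv (h \<circ> k) \<zeta>))\<^sup>2 - (norm (deriv (g \<circ> k) \<zeta>))\<^sup>2\<bar>" if "\<zeta> \<in> S" for \<zeta>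
        using composition_dilatation[OF kU kh kr] that SU by blast
      show "0 < bdist z" by (rule bdist_pos[OF z])
      show "ln (R / 2) < ln (3 * R / 4)" using R by simp
      fix x assume x: "ln (R / 2) < x" "x < ln (3 * R / 4)"
      define t where "t = exp x"
      have t: "R / 2 < t" "t < 3 * R / 4" using Rexp[of x] x by (auto simp: t_def)
      have cb: "cball z t \<subseteq> unit_disk"
        by (rule cball_subset_unit_disk) (use t R in \<open>simp add: R_def\<close>)
      obtain \<zeta> where \<zeta>: "dist z \<zeta> = t" "norm (f \<zeta> - f z) \<le> bdist z"
        using circle_image_meets_cball[OF _ cb] t R by auto
      obtain \<zeta>' where \<zeta>': "dist z \<zeta>' = t" "2 ^ n * bdist z < norm (f \<zeta>' - f z)"
        using neg t unfolding R_def by (auto simp: not_le)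
      have rep: "k (Complex x (Arg2pi (v - z))) = v" "Complex x (Arg2pi (v - z)) \<in> S" if "dist z v = t" for v
      proof -
        have nv: "norm (v - z) = exp x" using that by (simp add: t_def dist_norm norm_minus_commute)
        have "v - z = of_real (norm (v - z)) * exp (\<i> * of_real (Arg2pi (v - z)))" using Arg2pi_eq[of "v - z"] by simp
        also have "\<dots> = exp (of_real x + \<i> * of_real (Arg2pi (v - z)))" by (simp add: nv exp_add exp_of_real)
        finally show "k (Complex x (Arg2pi (v - z))) = v" by (simp add: k_def Complex_eq)
        show "Complex x (Arg2pi (v - z)) \<in> S" using x Arg2pi[of "v - z"] by (simp add: S_def)
      qed
      let ?\<alpha> = "Arg2pi (\<zeta> - z)" and ?\<beta> = "Arg2pi (\<zeta>' - z)"
      \<comment> \<open>The segment between the two angles stays in [0, 2 pi), so it is never cut at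
        the branch of the argument; the two angles may come in either order.\<close>
      have seg: "\<forall>y\<in>closed_segment ?\<alpha> ?\<beta>. Complex x y \<in> S"
        using rep(2)[OF \<zeta>(1)] rep(2)[OF \<zeta>'(1)] by (auto simp: S_def closed_segment_eq_real_ivl split: if_splits)
      have "(h \<circ> k) (Complex x ?\<alpha>) + cnj ((g \<circ> k) (Complex x ?\<alpha>)) = f \<zeta>"
           "(h \<circ> k) (Complex x ?\<beta>) + cnj ((g \<circ> k) (Complex x ?\<beta>)) = f \<zeta>'"
        using rep[OF \<zeta>(1)] rep[OF \<zeta>'(1)] Feq SU by (metis subsetD)+
      then show "\<exists>\<alpha> \<beta>. (\<forall>y\<in>closed_segment \<alpha> \<beta>. Complex x y \<in> S) \<and>
        norm ((h \<circ> k) (Complex x \<alpha>) + cnj ((g \<circ> k) (Complex x \<alpha>)) - f z) \<le> bdist z \<and>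
        2 ^ n * bdist z \<le> norm ((h \<circ> k) (Complex x \<beta>) + cnj ((g \<circ> k) (Complex x \<beta>)) - f z)"
        using seg \<zeta> \<zeta>' by (intro exI[of _ ?\<alpha>] exI[of _ ?\<beta>]) auto
    qed (use K n0 SU Sb in \<open>auto simp: S_def\<close>)
    also have "ln (3 * R / 4) - ln (R / 2) = ln (3 / 2)"
    proof -
      have "ln (3 * R / 4) = ln (3 / 2 * (R / 2))" by simp
      also have "\<dots> = ln (3 / 2) + ln (R / 2)" using R by (subst ln_mult) auto
      finally show ?thesis by simp
    qed
    finally show False using n by (simp add: power2_eq_square mult_ac)
  qed
qed

lemma local_lipschitz:
  "\<exists>C\<ge>1. \<forall>z\<in>unit_disk. \<forall>\<zeta>. norm (\<zeta> - z) \<le> (1 - norm z) / 4 \<longrightarrow>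
     norm (f \<zeta> - f z) \<le> C * bdist z * (norm (\<zeta> - z) / (1 - norm z))"
proof -
  obtain n :: nat where n: "\<And>z. z\<in>unit_disk \<Longrightarrow> \<exists>t. (1 - norm z) / 2 < t \<and> t < 3 * (1 - norm z) / 4 \<and>
     (\<forall>\<zeta>. dist z \<zeta> = t \<longrightarrow> norm (f \<zeta> - f z) \<le> 2 ^ n * bdist z)"
    using circle_image_bounded by blast
  show ?thesis
  \<comment> \<open>On the circle of radius t the real parts of \<open>p1\<close> and
    \<open>p2\<close> are at most M = 2^n d. Since t > R / 2 and |\<zeta> - z| \<le> R / 4, the
    denominator t - |\<zeta> - z| is at least R / 4, which gives 16 M |\<zeta> - z| / R for each.
    The differences of h and of g are half-sums of these up to a factor \<i>, so each inherits the
    16.\<close>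
  proof (intro exI[of _ "32 * 2 ^ n"] conjI ballI allI impI)
    show "(1::real) \<le> 32 * 2 ^ n" using one_le_power[of "2::real" n] by linarith
    fix z \<zeta> :: complex
    assume z: "z \<in> unit_disk" and \<zeta>: "norm (\<zeta> - z) \<le> (1 - norm z) / 4"
    define R where "R = 1 - norm z"
    define s where "s = norm (\<zeta> - z)"
    have R: "0 < R" using z by (simp add: R_def)
    obtain t where t: "R / 2 < t" "t < 3 * R / 4"
       "\<And>\<zeta>. dist z \<zeta> = t \<Longrightarrow> norm (f \<zeta> - f z) \<le> 2 ^ n * bdist z"
      using n[OF z] unfolding R_def by blast
    have cb: "cball z t \<subseteq> unit_disk"
      by (rule cball_subset_unit_disk) (use t R in \<open>simp add: R_def\<close>)
    define M where "M = 2 ^ n * bdist z"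
    have M: "0 < M" using bdist_pos[OF z] by (simp add: M_def)
    have s: "dist z \<zeta> = s" "s \<le> R / 4" "0 \<le> s" using \<zeta> by (auto simp: s_def R_def dist_norm norm_minus_commute)
    \<comment> \<open>p1 and p2 are holomorphic, with real parts the real and imaginary parts of f - f z\<close>
    define p1 where "p1 v = (h v - h z) + (g v - g z)" for v
    define p2 where "p2 v = - \<i> * ((h v - h z) - (g v - g z))" for v
    have bound: "norm (p \<zeta>) \<le> 16 * M * s / R"
      if p: "p holomorphic_on unit_disk" "p z = 0" "\<And>v. dist z v = t \<Longrightarrow> Re (p v) \<le> M" for p
    proof -
      have "norm (p \<zeta>) \<le> 4 * M * dist z \<zeta> / (t - dist z \<zeta>)"
        by (rule maximum_real_part_growth[OF p(1) cb p(2) M p(3)]) (use s t R in auto)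
      also have "\<dots> \<le> 4 * M * s / (R / 4)"
        unfolding s(1) by (rule divide_left_mono) (use s t R M in auto)
      finally show ?thesis by (simp add: field_simps)
    qed
    have fd: "f v - f z = (h v - h z) + cnj (g v - g z)" if "v \<in> unit_disk" for v
      using f_eq[OF that] f_eq[OF z] by simp
    have b1: "norm (p1 \<zeta>) \<le> 16 * M * s / R"
    proof (rule bound)
      show "p1 holomorphic_on unit_disk" unfolding p1_def by (intro holomorphic_intros hol)
      fix v assume v: "dist z v = t"
      then have "v \<in> unit_disk" using cb by auto
      then have "Re (p1 v) = Re (f v - f z)" by (simp add: fd p1_def)
      also have "\<dots> \<le> norm (f v - f z)" by (rule complex_Re_le_cmod)
      finally show "Re (p1 v) \<le> M" using t(3)[OF v] by (simp add: M_def)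
    qed (simp add: p1_def)
    have b2: "norm (p2 \<zeta>) \<le> 16 * M * s / R"
    proof (rule bound)
      show "p2 holomorphic_on unit_disk" unfolding p2_def by (intro holomorphic_intros hol)
      fix v assume v: "dist z v = t"
      then have "v \<in> unit_disk" using cb by auto
      then have "Re (p2 v) = Im (f v - f z)" by (simp add: fd p2_def)
      also have "\<dots> \<le> norm (f v - f z)" by (metis abs_Im_le_cmod abs_le_D1)
      finally show "Re (p2 v) \<le> M" using t(3)[OF v] by (simp add: M_def)
    qed (simp add: p2_def)
    have "\<zeta> \<in> unit_disk" using cb s t R by (auto simp: subset_iff)
    have "h \<zeta> - h z = (p1 \<zeta> + \<i> * p2 \<zeta>) / 2" "g \<zeta> - g z = (p1 \<zeta> - \<i> * p2 \<zeta>) / 2"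
      by (auto simp: p1_def p2_def field_simps)
    then have "norm (h \<zeta> - h z) = norm (p1 \<zeta> + \<i> * p2 \<zeta>) / 2" "norm (g \<zeta> - g z) = norm (p1 \<zeta> - \<i> * p2 \<zeta>) / 2"
      by (simp_all only: norm_divide norm_numeral)
    moreover have "norm (\<i> * p2 \<zeta>) = norm (p2 \<zeta>)" by (simp add: norm_mult)
    ultimately have hg: "norm (h \<zeta> - h z) \<le> 16 * M * s / R" "norm (g \<zeta> - g z) \<le> 16 * M * s / R"
      using b1 b2 norm_triangle_ineq[of "p1 \<zeta>" "\<i> * p2 \<zeta>"] norm_triangle_ineq4[of "p1 \<zeta>" "\<i> * p2 \<zeta>"]
      by linarith+
    have "norm (f \<zeta> - f z) \<le> norm (h \<zeta> - h z) + norm (g \<zeta> - g z)"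
      unfolding fd[OF \<open>\<zeta> \<in> unit_disk\<close>] by (metis complex_mod_cnj norm_triangle_ineq)
    also have "\<dots> \<le> 32 * M * s / R" using hg by simp
    finally show "norm (f \<zeta> - f z) \<le> 32 * 2 ^ n * bdist z * (norm (\<zeta> - z) / (1 - norm z))"
      by (simp add: M_def s_def R_def)
  qed
qed

text \<open>
  The curves of the length-area argument are segments at 45 degrees to the radius, from the
  radius to the unit circle; their length is comparable with 1 - r, unlike that of
  perpendicular chords. The factor k rotates them to the vertical direction.
\<close>

lemma radial_escape:
  "\<exists>\<epsilon>>0. \<forall>(u::complex) (r::real). norm u = 1 \<and> 0 \<le> r \<and> r < 1 \<longrightarrow>
     (\<exists>\<rho>::real. r \<le> \<rho> \<and> \<rho> \<le> (1 + r) / 2 \<and> \<epsilon> * bdist (of_real r * u) \<le> norm (f (of_real \<rho> * u) - f (of_real r * u)))"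
proof -
  \<comment> \<open>This contradicts length-area for a strip of width (1 - r) / (2 sqrt 2) and
    height 2 (1 - r); the factor 1 - r cancels.\<close>
  obtain n :: nat where n: "16 * sqrt 2 * pi * K < real n" using reals_Archimedean2 by blast
  have "0 < 16 * sqrt 2 * pi * K" using K by simp
  then have n0: "0 < n" using n by (metis of_nat_0_less_iff less_trans)
  show ?thesis
  \<comment> \<open>If f moved less than d / 2^(n+1) along the radial segment, then n doublings of
    this distance would give d / 2, which the crossing segments are shown to reach.\<close>
  proof (rule exI[of _ "1 / 2 ^ Suc n"], intro conjI allI impI, simp, rule ccontr)
    fix u :: complex and r :: real
    assume ur: "norm u = 1 \<and> 0 \<le> r \<and> r < 1"
    assume *: "\<not> (\<exists>\<rho>\<ge>r. \<rho> \<le> (1 + r) / 2 \<and> 1 / 2 ^ Suc n * bdist (of_real r * u) \<le> norm (f (of_real \<rho> * u) - f (of_real r * u)))"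
    then have neg: "norm (f (of_real \<rho> * u) - f (of_real r * u)) < bdist (of_real r * u) / 2 ^ Suc n" if "r \<le> \<rho>" "\<rho> \<le> (1 + r) / 2" for \<rho> :: real
    proof -
      from that have "\<not> 1 / 2 ^ Suc n * bdist (of_real r * u) \<le> norm (f (of_real \<rho> * u) - f (of_real r * u))"
        using * by blast
      then show ?thesis by simp
    qed
    have u: "norm u = 1" and r: "0 \<le> r" "r < 1" using ur by auto
    define z where "z = of_real r * u"
    have z: "z \<in> unit_disk" using u r by (simp add: z_def norm_mult)
    define d where "d = bdist z"
    have d: "0 < d" unfolding d_def by (rule bdist_pos[OF z])
    \<comment> \<open>The constant is exp (- \<i> pi / 4), so k takes the diagonal point Complex x x
      to the point of the radius at distance sqrt 2 x from 0. This explains the factors sqrt 2 in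
      \<open>x0\<close> and \<open>x1\<close>, which match the radii r and (1 + r) / 2.\<close>
    define k where "k \<zeta> = u * Complex (1 / sqrt 2) (- 1 / sqrt 2) * \<zeta>" for \<zeta>
    have "norm (Complex (1 / sqrt 2) (- 1 / sqrt 2)) = 1" by (simp add: cmod_def power_divide)
    then have nk: "norm (k \<zeta>) = norm \<zeta>" for \<zeta> using u by (simp add: k_def norm_mult)
    have kdiag: "k (Complex x x) = of_real (sqrt 2 * x) * u" for x
    proof -
      have "x / sqrt 2 + x / sqrt 2 = sqrt 2 * x"
        using real_div_sqrt[of 2] by (simp add: field_simps)
      then have "Complex (1 / sqrt 2) (- 1 / sqrt 2) * Complex x x = of_real (sqrt 2 * x)"
        by (simp add: complex_eq_iff)
      then show ?thesis by (simp add: k_def mult_ac)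
    qed
    have kh: "k holomorphic_on unit_disk" unfolding k_def by (intro holomorphic_intros)
    have kr: "k \<in> unit_disk \<rightarrow> unit_disk" using nk by auto
    have Feq: "(h \<circ> k) \<zeta> + cnj ((g \<circ> k) \<zeta>) = f (k \<zeta>)" if "\<zeta> \<in> unit_disk" for \<zeta>
      using f_eq[of "k \<zeta>"] that nk by simp
    have injk: "a = b" if "k a = k b" for a b
    proof -
      have "k (a - b) = k a - k b" by (simp add: k_def right_diff_distrib)
      then show ?thesis using nk[of "a - b"] that by simp
    qed
    define x0 where "x0 = r / sqrt 2"
    define x1 where "x1 = (1 + r) / (2 * sqrt 2)"
    define S where "S = {\<zeta>. norm \<zeta> < 1 \<and> x0 < Re \<zeta> \<and> Re \<zeta> < x1 \<and> x0 \<le> Im \<zeta>}"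
    have Sb: "S \<in> sets borel" unfolding S_def by measurable
    have x0: "0 \<le> x0" using r by (simp add: x0_def)
    have x01: "x1 - x0 = (1 - r) / (2 * sqrt 2)" by (simp add: x0_def x1_def field_simps)
    have x: "r < sqrt 2 * x" "sqrt 2 * x < (1 + r) / 2" if "x0 < x" "x < x1" for x
      using that by (auto simp: x0_def x1_def field_simps)
    \<comment> \<open>At greater height the squared norm would be at least x0^2 + (x0 + 2 (1 -
      r))^2. With x0^2 = r^2 / 2 and x0 \<ge> r / 2 this is at least (r + (1 - r))^2 + 3 (1 - r)^2 >
      1.\<close>
    have strip: "Im \<zeta> \<le> x0 + 2 * (1 - r)" if "\<zeta> \<in> S" for \<zeta>
    proof (rule ccontr)
      assume "\<not> ?thesis"
      then have "(x0 + 2 * (1 - r))\<^sup>2 \<le> (Im \<zeta>)\<^sup>2" using x0 r by (intro power_mono) auto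
      moreover have "x0\<^sup>2 \<le> (Re \<zeta>)\<^sup>2" using that x0 by (intro power_mono) (auto simp: S_def)
      moreover have "(Re \<zeta>)\<^sup>2 + (Im \<zeta>)\<^sup>2 < 1"
        using that by (simp add: S_def cmod_def real_sqrt_lt_1_iff)
      moreover have "1 \<le> x0\<^sup>2 + (x0 + 2 * (1 - r))\<^sup>2"
      proof -
        have xr: "x0\<^sup>2 = r\<^sup>2 / 2" by (simp add: x0_def power_divide)
        have "r / 2 \<le> x0" unfolding x0_def using r sqrt2_less_2 by (intro frac_le) auto
        then have "4 * (r / 2) * (1 - r) \<le> 4 * x0 * (1 - r)" using r by (intro mult_right_mono) auto
        moreover have "1 \<le> r\<^sup>2 + 2 * r * (1 - r) + 4 * (1 - r)\<^sup>2"
        proof -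
          have "r\<^sup>2 + 2 * r * (1 - r) + 4 * (1 - r)\<^sup>2 - 1 = 3 * (1 - r)\<^sup>2"
            by (simp add: power2_eq_square algebra_simps)
          then show ?thesis using zero_le_power2[of "1 - r"] by linarith
        qed
        ultimately show ?thesis using xr by (simp add: power2_eq_square algebra_simps)
      qed
      ultimately show False by linarith
    qed
    \<comment> \<open>The closed disk of radius d / 2 about f z lies in the image, and its preimage
      is compact, hence contained in a disk of radius m < 1. Past that radius f is farther than d /
      2 from f z.\<close>
    obtain m where m: "m < 1" "\<And>v. v \<in> unit_disk \<Longrightarrow> norm (f v - f z) \<le> d / 2 \<Longrightarrow> norm v \<le> m"
    proof -
      obtain fi where fi: "homeomorphism unit_disk (f ` unit_disk) f fi"
        using invariance_of_domain_homeomorphism[OF _ continuous_on_f _ inj] by auto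
      have sub: "cball (f z) (d / 2) \<subseteq> f ` unit_disk"
        using ball_bdist_subset[OF z] d unfolding d_def by (force simp: subset_iff)
      have "compact (fi ` cball (f z) (d / 2))"
        by (rule compact_continuous_image[OF continuous_on_subset[OF homeomorphism_cont2[OF fi] sub]]) simp
      moreover have "fi ` cball (f z) (d / 2) \<noteq> {}" using d by auto
      ultimately obtain v0 where v0: "v0 \<in> fi ` cball (f z) (d / 2)" "\<And>v. v \<in> fi ` cball (f z) (d / 2) \<Longrightarrow> norm v \<le> norm v0"
        using continuous_attains_sup[OF _ _ continuous_on_norm_id, of "fi ` cball (f z) (d / 2)"] by blast
      have "fi ` cball (f z) (d / 2) \<subseteq> unit_disk"
        using image_mono[OF sub, of fi] homeomorphism_image2[OF fi] by (rule subset_trans[OF _ equalityD1])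
      then have "norm v0 < 1" using v0(1) by auto
      then show thesis
      proof (rule that)
        fix v assume v: "v \<in> unit_disk" "norm (f v - f z) \<le> d / 2"
        have "fi (f v) = v" by (rule homeomorphism_apply1[OF fi v(1)])
        moreover have "f v \<in> cball (f z) (d / 2)" using v by (simp add: dist_norm norm_minus_commute)
        ultimately show "norm v \<le> norm v0" using v0(2) by (metis imageI)
      qed
    qed
    have "real n * (x1 - x0) \<le> 4 * pi * K * (2 * (1 - r))"
    proof (rule length_area[where H = "h \<circ> k" and G = "g \<circ> k" and U = unit_disk and S = S and w = "f z" and a = "d / 2 ^ Suc n" and ?y0.0 = x0])
      show "h \<circ> k holomorphic_on unit_disk" "g \<circ> k holomorphic_on unit_disk"
        using kr hol by (auto intro!: holomorphic_on_compose_gen[OF kh])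
      show "inj_on (\<lambda>z. (h \<circ> k) z + cnj ((g \<circ> k) z)) S"
      proof (rule inj_onI)
        fix a b assume ab: "a \<in> S" "b \<in> S" "(h \<circ> k) a + cnj ((g \<circ> k) a) = (h \<circ> k) b + cnj ((g \<circ> k) b)"
        then have D: "a \<in> unit_disk" "b \<in> unit_disk" by (auto simp: S_def)
        have "f (k a) = f (k b)" using ab(3) Feq[OF D(1)] Feq[OF D(2)] by simp
        moreover have "k a \<in> unit_disk" "k b \<in> unit_disk" using kr D by blast+
        ultimately have "k a = k b" by (rule inj_onD[OF inj])
        then show "a = b" by (rule injk)
      qed
      show "(norm (deriv (h \<circ> k) \<zeta>) + norm (deriv (g \<circ> k) \<zeta>))\<^sup>2
          \<le> K * \<bar>(norm (deriv (h \<circ> k) \<zeta>))\<^sup>2 - (norm (deriv (g \<circ> k) \<zeta>))\<^sup>2\<bar>" if "\<zeta> \<in> S" for \<zeta>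
        using composition_dilatation[OF open_ball kh kr] that by (simp add: S_def)
      show "x0 \<le> Im \<zeta> \<and> Im \<zeta> \<le> x0 + 2 * (1 - r)" if "\<zeta> \<in> S" for \<zeta>
        using strip[OF that] that by (simp add: S_def)
      have "0 < (1 - r) / (2 * sqrt 2)" using r by simp
      then show "x0 < x1" using x01 by linarith
      show "0 < d / 2 ^ Suc n" using d by simp
      show "0 \<le> K" using K by simp
      show "S \<subseteq> unit_disk" by (auto simp: S_def)
      fix x assume xx: "x0 < x" "x < x1"
      \<comment> \<open>The vertical segment from the diagonal is stopped on the circle of radius q.
        It must lie beyond m, so that f has moved away, and beyond sqrt 2 x, so that the endpoint is
        above the diagonal.\<close>
      define q where "q = (1 + max m (sqrt 2 * x)) / 2"
      have q: "m < q" "sqrt 2 * x < q" "q < 1" using m(1) x[OF xx] r by (auto simp: q_def)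
      have x_pos: "0 < x" using xx x0 by simp
      have qx: "2 * x\<^sup>2 \<le> q\<^sup>2"
      proof -
        have "(sqrt 2 * x)\<^sup>2 \<le> q\<^sup>2" using q x_pos by (intro power_mono) auto
        then show ?thesis by (simp add: power_mult_distrib)
      qed
      define y where "y = sqrt (q\<^sup>2 - x\<^sup>2)"
      have y2: "y\<^sup>2 = q\<^sup>2 - x\<^sup>2" unfolding y_def using qx zero_le_power2[of x] by (intro real_sqrt_pow2) linarith
      have "x \<le> y" unfolding y_def using qx by (intro real_le_rsqrt) simp
      have q_pos: "0 < q" using q(2) x_pos by (smt (verit) mult_pos_pos real_sqrt_gt_0_iff)
      have ny: "norm (Complex x y) = q" using q_pos by (simp add: cmod_def y2)
      have seg: "Complex x v \<in> S" if "v \<in> closed_segment x y" for v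
      proof -
        have v: "x \<le> v" "v \<le> y" using that \<open>x \<le> y\<close> by (auto simp: closed_segment_eq_real_ivl)
        have "v\<^sup>2 \<le> y\<^sup>2" using v x_pos by (intro power_mono) auto
        then have "norm (Complex x v) \<le> norm (Complex x y)" by (simp add: cmod_def)
        then show ?thesis using ny q v xx by (simp add: S_def)
      qed
      have SD: "Complex x x \<in> unit_disk" "Complex x y \<in> unit_disk" using seg[of x] seg[of y] by (auto simp: S_def)
      have "norm (f (k (Complex x x)) - f z) \<le> d / 2 ^ Suc n"
        unfolding kdiag z_def d_def using x[OF xx] by (intro less_imp_le[OF neg]) auto
      moreover have "d / 2 \<le> norm (f (k (Complex x y)) - f z)"
      proof (rule ccontr)
        assume "\<not> ?thesis"
        then have "norm (k (Complex x y)) \<le> m" using SD(2) kr by (intro m(2)) auto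
        then show False using nk[of "Complex x y"] ny q by simp
      qed
      ultimately show "\<exists>\<alpha> \<beta>. (\<forall>y\<in>closed_segment \<alpha> \<beta>. Complex x y \<in> S) \<and>
        norm ((h \<circ> k) (Complex x \<alpha>) + cnj ((g \<circ> k) (Complex x \<alpha>)) - f z) \<le> d / 2 ^ Suc n \<and>
        2 ^ n * (d / 2 ^ Suc n) \<le> norm ((h \<circ> k) (Complex x \<beta>) + cnj ((g \<circ> k) (Complex x \<beta>)) - f z)"
        using seg Feq[OF SD(1)] Feq[OF SD(2)] by (intro exI[of _ x] exI[of _ y]) simp
    qed (use n0 r Sb in auto)
    then have "real n * (1 - r) \<le> 16 * sqrt 2 * pi * K * (1 - r)"
      unfolding x01 by (simp add: field_simps)
    then show False using n r by simp
  qed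
qed

end

section \<open>Radial John disks\<close>

text \<open>A discrete Gronwall argument: the first term of each tail is at least 1 / A of the tail,
  so dropping it multiplies the tail by at most 1 - 1 / A. The tails are cut after index n, so the
  last one is d n itself.\<close>

lemma geometric_decay_of_tail_sums:
  fixes d :: "nat \<Rightarrow> real"
  assumes A: "1 \<le> A" and d: "\<And>i. 0 \<le> d i"
    and tail: "\<And>m N. (\<Sum>i=m..<N. d i) \<le> A * d m"
  shows "d n \<le> A * (1 - 1 / A) ^ n * d 0"
proof -
  define s where "s m = (\<Sum>i=m..<Suc n. d i)" for m
  have "s m \<le> (1 - 1 / A) ^ m * s 0" if "m \<le> n" for m
    using that
  proof (induction m)
    case (Suc m)
    have "s m = d m + s (Suc m)" unfolding s_def using Suc.prems by (intro sum.atLeast_Suc_lessThan) auto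
    moreover have "s m / A \<le> d m" using tail[of m "Suc n"] A by (simp add: s_def divide_le_eq mult.commute)
    ultimately have "s (Suc m) \<le> (1 - 1 / A) * s m" by (simp add: left_diff_distrib)
    also have "\<dots> \<le> (1 - 1 / A) * ((1 - 1 / A) ^ m * s 0)" using Suc A by (intro mult_left_mono) auto
    finally show ?case by (simp add: mult_ac)
  qed simp
  from this[of n] have "d n \<le> (1 - 1 / A) ^ n * s 0" by (simp add: s_def)
  also have "\<dots> \<le> (1 - 1 / A) ^ n * (A * d 0)"
    using tail[of 0 "Suc n"] A by (intro mult_left_mono) (auto simp: s_def)
  finally show ?thesis by (simp add: mult_ac)
qed

section \<open>Plane geometry of radii and boxes\<close>

lemma norm_cis_diff_le: "norm (cis a - cis b) \<le> \<bar>a - b\<bar>"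
proof -
  have "cis a - cis b = cis b * (cis (a - b) - 1)" by (simp add: algebra_simps cis_mult)
  then have "norm (cis a - cis b) = norm (exp (\<i> * of_real (a - b)) - 1)"
    by (simp add: norm_mult cis_conv_exp)
  also have "\<dots> = 2 * \<bar>sin ((a - b) / 2)\<bar>" by (rule dist_exp_i_1)
  also have "\<dots> \<le> 2 * \<bar>(a - b) / 2\<bar>" by (intro mult_left_mono abs_sin_x_le_abs_x) auto
  finally show ?thesis by simp
qed

text \<open>The squared distance of a u and b v is (a - b)^2 + 2 a b (1 - <u, v>), and both terms
  can only drop when a and b are replaced by p.\<close>

lemma radial_projection_contracts:
  fixes u v :: complex
  assumes "norm u = 1" "norm v = 1" "0 \<le> p" "p \<le> a" "p \<le> b"
  shows "norm (of_real p * u - of_real p * v) \<le> norm (of_real a * u - of_real b * v)"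
proof (rule power2_le_imp_le)
  have sq: "(norm (of_real x * u - of_real y * v))\<^sup>2 = x\<^sup>2 + y\<^sup>2 - 2 * x * y * inner u v" for x y :: real
  proof -
    have "(Re u)\<^sup>2 + (Im u)\<^sup>2 = 1" "(Re v)\<^sup>2 + (Im v)\<^sup>2 = 1" using assms by (simp_all flip: cmod_power2)
    then have "x\<^sup>2 * ((Re u)\<^sup>2 + (Im u)\<^sup>2) + y\<^sup>2 * ((Re v)\<^sup>2 + (Im v)\<^sup>2) = x\<^sup>2 + y\<^sup>2" by simp
    then show ?thesis unfolding cmod_power2 by (simp add: inner_complex_def power2_eq_square algebra_simps)
  qed
  have "inner u v \<le> 1" using norm_cauchy_schwarz[of u v] assms by simp
  moreover have "p * p \<le> a * b" using assms by (intro mult_mono) auto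
  ultimately have "2 * (p * p) * (1 - inner u v) \<le> 2 * (a * b) * (1 - inner u v)"
    by (intro mult_right_mono mult_left_mono) auto
  moreover have "2 * a * b \<le> a\<^sup>2 + b\<^sup>2" using sum_squares_bound[of a b] by simp
  ultimately show "(norm (of_real p * u - of_real p * v))\<^sup>2 \<le> (norm (of_real a * u - of_real b * v))\<^sup>2"
    unfolding sq by (simp add: power2_eq_square algebra_simps)
qed simp

text \<open>Absorbs the multiple of 2 pi: the radius through \<zeta> meets the circle through z at z
  rotated by an angle \<phi> of controlled size, where \<open>arc_oscillation\<close>
  applies.\<close>

lemma Carleson_box_polar:
  assumes "\<zeta> \<in> Carleson_box z" "z \<noteq> 0"
  obtains u \<phi> where "norm u = 1" "\<zeta> = of_real (norm \<zeta>) * u" "of_real (norm z) * u = z * cis \<phi>" "\<bar>\<phi>\<bar> \<le> pi * (1 - norm z)"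
proof -
  obtain k :: int where k: "\<bar>Arg z - Arg \<zeta> + 2 * pi * of_int k\<bar> \<le> pi * (1 - norm z)"
    using assms by (auto simp: Carleson_box_def)
  let ?\<phi> = "- (Arg z - Arg \<zeta> + 2 * pi * of_int k)"
  show thesis
  proof (rule that)
    show "norm (cis (Arg \<zeta>)) = 1" by simp
    show "\<zeta> = of_real (norm \<zeta>) * cis (Arg \<zeta>)" by (metis rcis_cmod_Arg rcis_def)
    have "cis (2 * pi * of_int k) = 1" by (rule cis_multiple_2pi) simp
    moreover have "cis (Arg \<zeta>) = cis (Arg z) * cis ?\<phi> * cis (2 * pi * of_int k)"
      by (simp only: cis_mult) simp
    ultimately have "cis (Arg z) * cis ?\<phi> = cis (Arg \<zeta>)" by simp
    moreover have "z = of_real (norm z) * cis (Arg z)" by (metis rcis_cmod_Arg rcis_def)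
    ultimately show "of_real (norm z) * cis (Arg \<zeta>) = z * cis ?\<phi>" by (metis mult.assoc)
    show "\<bar>?\<phi>\<bar> \<le> pi * (1 - norm z)" using k by simp
  qed
qed

section \<open>Decay of the boundary distance and the Hoelder estimate\<close>

locale radial_John_qc = harmonic_qc_disk +
  fixes c :: real
  assumes c: "1 \<le> c"
    and John: "\<And>z s. z \<in> unit_disk \<Longrightarrow> s \<in> {0..1} \<Longrightarrow>
      curve_length (f \<circ> linepath 0 z) s 1 \<le> ennreal (c * boundary_dist (f ` unit_disk) ((f \<circ> linepath 0 z) s))"
begin

text \<open>The inscribed polygon is no longer than the subarc from t 0 to t N, and the John
  condition for the radius ending at t N bounds that subarc by c times the boundary distance at its
  inner end.\<close>

lemma radial_variation:
  fixes t :: "nat \<Rightarrow> real" and u :: complex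
  assumes u: "norm u = 1" and t: "incseq t" "0 \<le> t 0" "\<And>i. t i < 1"
  shows "(\<Sum>i<N. norm (f (of_real (t (Suc i)) * u) - f (of_real (t i) * u))) \<le> c * bdist (of_real (t 0) * u)"
proof (cases "t N = 0")
  case True
  have "t i = 0" if "i \<le> N" for i
    using incseqD[OF t(1), of 0 i] incseqD[OF t(1) that] t(2) True by simp
  then have "(\<Sum>i<N. norm (f (of_real (t (Suc i)) * u) - f (of_real (t i) * u))) = 0" by (intro sum.neutral) auto
  then show ?thesis using c bdist_nonneg[of "of_real (t 0) * u"] by simp
next
  case False
  have tN: "0 < t N" using incseqD[OF t(1), of 0 N] t(2) False by simp
  define z where "z = of_real (t N) * u"
  have z: "z \<in> unit_disk" using u t(3)[of N] tN by (simp add: z_def norm_mult)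
  \<comment> \<open>\<open>curve_length\<close> ranges over infinite nondecreasing sequences in the
    parameter interval, so the partition is rescaled to end at 1 and kept constant after index N.
    The division is why t N = 0 is treated separately.\<close>
  define \<tau> where "\<tau> i = t (min i N) / t N" for i
  have \<tau>: "linepath 0 z (\<tau> i) = of_real (t i) * u" if "i \<le> N" for i
    using that tN by (simp add: linepath_def \<tau>_def z_def scaleR_conv_of_real)
  have inc: "incseq \<tau>" unfolding \<tau>_def using tN t(1)
    by (auto intro!: incseq_SucI divide_right_mono simp: incseq_def)
  have rng: "range \<tau> \<subseteq> {\<tau> 0..1}"
    using inc tN t(1) by (auto simp: incseq_def) (simp add: \<tau>_def incseqD[OF t(1)])
  have t0: "\<tau> 0 \<in> {0..1}" using tN t(2) incseqD[OF t(1), of 0 N] by (simp add: \<tau>_def)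
  have "ennreal (\<Sum>i<N. norm (f (of_real (t (Suc i)) * u) - f (of_real (t i) * u)))
     = (\<Sum>i<N. ennreal (dist (f (of_real (t i) * u)) (f (of_real (t (Suc i)) * u))))"
    by (simp add: sum_ennreal dist_norm norm_minus_commute)
  also have "\<dots> = (\<Sum>i<N. ennreal (dist ((f \<circ> linepath 0 z) (\<tau> i)) ((f \<circ> linepath 0 z) (\<tau> (Suc i)))))"
    by (intro sum.cong refl) (simp only: comp_def \<tau> Suc_le_eq lessThan_iff less_imp_le)
  also have "\<dots> \<le> curve_length (f \<circ> linepath 0 z) (\<tau> 0) 1"
    unfolding curve_length_def
    by (rule SUP_upper2[of "(N, \<tau>)"]) (use inc rng in auto)
  also have "\<dots> \<le> ennreal (c * bdist (of_real (t 0) * u))"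
    using John[OF z t0] \<tau>[of 0] by (simp add: bdist_def)
  finally show ?thesis
    by (subst (asm) ennreal_le_iff) (use c in \<open>auto simp: bdist_nonneg\<close>)
qed

lemma radial_oscillation:
  fixes u :: complex and r \<rho> :: real
  assumes "norm u = 1" "0 \<le> r" "r \<le> \<rho>" "\<rho> < 1"
  shows "norm (f (of_real \<rho> * u) - f (of_real r * u)) \<le> c * bdist (of_real r * u)"
  using radial_variation[of u "\<lambda>i. if i = 0 then r else \<rho>" 1] assms by (auto simp: incseq_def)

lemma bdist_decay:
  "\<exists>\<delta> C. 0 < \<delta> \<and> \<delta> < 1 \<and> 0 < C \<and> (\<forall>(u::complex) (r::real) (\<rho>::real). norm u = 1 \<and> 0 \<le> r \<and> r \<le> \<rho> \<and> \<rho> < 1 \<longrightarrow>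
     bdist (of_real \<rho> * u) \<le> C * ((1 - \<rho>) / (1 - r)) powr \<delta> * bdist (of_real r * u))"
proof -
  obtain \<epsilon> where \<epsilon>: "0 < \<epsilon>" and esc: "\<And>(u::complex) (r::real). norm u = 1 \<Longrightarrow> 0 \<le> r \<Longrightarrow> r < 1 \<Longrightarrow>
     \<exists>\<rho>::real. r \<le> \<rho> \<and> \<rho> \<le> (1 + r) / 2 \<and> \<epsilon> * bdist (of_real r * u) \<le> norm (f (of_real \<rho> * u) - f (of_real r * u))"
    using radial_escape by blast
  \<comment> \<open>The tail sums need c / \<epsilon>. The summand 4 makes q = 1 - 1 / A larger than
    1 / 2, so that the exponent \<delta> given by q = 2 powr - \<delta> stays below 1.\<close>
  define A where "A = 4 + c / \<epsilon>"
  have A: "4 \<le> A" using c \<epsilon> by (simp add: A_def)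
  define q where "q = 1 - 1 / A"
  have q: "1 / 2 < q" "q < 1" using A by (auto simp: q_def field_simps)
  define \<delta> where "\<delta> = - log 2 q"
  have \<delta>: "0 < \<delta>" "\<delta> < 1"
  proof -
    show "0 < \<delta>" using q by (simp add: \<delta>_def)
    have "log 2 (1 / 2) < log 2 q" using q by (subst log_less_cancel_iff) auto
    then show "\<delta> < 1" by (simp add: \<delta>_def log_divide)
  qed
  have q_powr: "q ^ n = (1 / 2 ^ n) powr \<delta>" for n
  proof -
    have "(1 / 2 ^ n) powr \<delta> = (2 powr - real n) powr \<delta>"
      by (simp add: powr_minus powr_realpow divide_simps)
    also have "\<dots> = (2 powr log 2 q) powr real n" by (simp add: powr_powr \<delta>_def mult.commute)
    also have "\<dots> = q ^ n" using q by (simp add: powr_realpow)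
    finally show ?thesis by simp
  qed
  have dyadic: "bdist (of_real (1 - (1 - r) / 2 ^ n) * u) \<le> A * q ^ n * bdist (of_real r * u)"
    if u: "norm u = 1" and r: "0 \<le> r" "r < 1" for u :: complex and r :: real and n :: nat
  proof -
    define R where "R i = 1 - (1 - r) / 2 ^ i" for i :: nat
    have R01: "0 \<le> R i" "R i < 1" for i
    proof -
      have "(1 - r) / 2 ^ i \<le> (1 - r) / 1" using r by (intro frac_le) auto
      then show "0 \<le> R i"
        unfolding R_def diff_ge_0_iff_ge by (rule order_trans) (use r in simp)
      show "R i < 1" using r by (simp add: R_def)
    qed
    have RS: "(1 + R i) / 2 = R (Suc i)" for i by (simp add: R_def field_simps)
    obtain \<sigma> where \<sigma>: "\<And>i. R i \<le> \<sigma> i" "\<And>i. \<sigma> i \<le> R (Suc i)"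
      "\<And>i. \<epsilon> * bdist (of_real (R i) * u) \<le> norm (f (of_real (\<sigma> i) * u) - f (of_real (R i) * u))"
      using esc[OF u R01] unfolding RS by metis
    have tail: "(\<Sum>i=m..<N. bdist (of_real (R i) * u)) \<le> A * bdist (of_real (R m) * u)" for m N
    proof (cases "m \<le> N")
      case True
      \<comment> \<open>Interlaces the dyadic radii with the escape points. The steps from R i to
        \<sigma> i carry the lower bounds; those from \<sigma> i to R (i + 1) are discarded.\<close>
      define t where "t j = (if even j then R (m + j div 2) else \<sigma> (m + j div 2))" for j
      have tinc: "incseq t"
      proof (rule incseq_SucI)
        fix j show "t j \<le> t (Suc j)"
          using \<sigma>(1)[of "m + j div 2"] \<sigma>(2)[of "m + j div 2"] by (auto simp: t_def elim!: evenE oddE)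
      qed
      have t1: "t j < 1" for j
        using R01(2)[of "m + j div 2"] le_less_trans[OF \<sigma>(2)[of "m + j div 2"] R01(2)] by (simp add: t_def)
      have "(\<Sum>i=m..<m + M. \<epsilon> * bdist (of_real (R i) * u)) \<le> (\<Sum>j<2 * M. norm (f (of_real (t (Suc j)) * u) - f (of_real (t j) * u)))" for M
      proof (induction M)
        case (Suc M)
        have "t (2 * M) = R (m + M)" "t (Suc (2 * M)) = \<sigma> (m + M)" by (simp_all add: t_def)
        then have "\<epsilon> * bdist (of_real (R (m + M)) * u) \<le> norm (f (of_real (t (Suc (2 * M))) * u) - f (of_real (t (2 * M)) * u))"
          using \<sigma>(3)[of "m + M"] by simp
        then show ?case using Suc by (simp add: add_increasing2)
      qed simp
      from this[of "N - m"] have "(\<Sum>i=m..<N. \<epsilon> * bdist (of_real (R i) * u)) \<le> (\<Sum>j<2 * (N - m). norm (f (of_real (t (Suc j)) * u) - f (of_real (t j) * u)))"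
        using True by simp
      also have "\<dots> \<le> c * bdist (of_real (t 0) * u)"
        by (rule radial_variation[OF u tinc _ t1]) (use R01 in \<open>simp add: t_def\<close>)
      also have "t 0 = R m" by (simp add: t_def)
      finally have "\<epsilon> * (\<Sum>i=m..<N. bdist (of_real (R i) * u)) \<le> c * bdist (of_real (R m) * u)" by (simp add: sum_distrib_left)
      then have "(\<Sum>i=m..<N. bdist (of_real (R i) * u)) \<le> c / \<epsilon> * bdist (of_real (R m) * u)" using \<epsilon> by (simp add: field_simps)
      also have "\<dots> \<le> A * bdist (of_real (R m) * u)" by (intro mult_right_mono bdist_nonneg) (simp add: A_def)
      finally show ?thesis .
    next
      case False
      then show ?thesis using A bdist_nonneg by simp
    qed
    have "bdist (of_real (R n) * u) \<le> A * (1 - 1 / A) ^ n * bdist (of_real (R 0) * u)"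
      by (rule geometric_decay_of_tail_sums[OF _ bdist_nonneg tail]) (use A in simp)
    then show ?thesis by (simp add: R_def q_def)
  qed
  show ?thesis
  proof (rule exI[of _ \<delta>], rule exI[of _ "2 * (1 + c) * A"], intro conjI allI impI \<delta>)
    show "0 < 2 * (1 + c) * A" using c A by simp
    fix u :: complex and r \<rho> :: real
    assume "norm u = 1 \<and> 0 \<le> r \<and> r \<le> \<rho> \<and> \<rho> < 1"
    then have u: "norm u = 1" and r: "0 \<le> r" "r \<le> \<rho>" "\<rho> < 1" by auto
    define X where "X = (1 - r) / (1 - \<rho>)"
    have X: "1 \<le> X" using r by (simp add: X_def)
    \<comment> \<open>The largest n with 2^n \<le> X, so that R is the last dyadic radius not beyond
      \<rho>. Passing from R to \<rho> costs the factor 1 + c, and 1 / 2^n < 2 / X costs the factor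
      2.\<close>
    define n where "n = nat \<lfloor>log 2 X\<rfloor>"
    have "0 \<le> log 2 X" using X by simp
    then have "real n \<le> log 2 X" "log 2 X < real n + 1" unfolding n_def by linarith+
    then have "2 powr real n \<le> X" "X < 2 powr (real n + 1)"
      using X by (auto simp: le_log_iff less_log_iff log_less_iff)
    then have nX: "2 ^ n \<le> X" "X < 2 * 2 ^ n" by (simp_all add: powr_add powr_realpow)
    define R where "R = 1 - (1 - r) / 2 ^ n"
    have "2 ^ n * (1 - \<rho>) \<le> 1 - r" using nX(1) r by (simp add: X_def field_simps)
    then have R: "R \<le> \<rho>" by (simp add: R_def field_simps)
    have "(1 - r) / 2 ^ n \<le> (1 - r) / 1" using r by (intro frac_le) auto
    then have R0: "0 \<le> R"
      unfolding R_def diff_ge_0_iff_ge by (rule order_trans) (use r in simp)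
    have "bdist (of_real \<rho> * u) \<le> bdist (of_real R * u) + norm (f (of_real \<rho> * u) - f (of_real R * u))"
      using bdist_lipschitz[of "\<rho> * u" "R * u"] by linarith
    also have "\<dots> \<le> (1 + c) * bdist (of_real R * u)"
      using radial_oscillation[OF u R0 R r(3)] by (simp add: algebra_simps)
    also have "\<dots> \<le> (1 + c) * (A * q ^ n * bdist (of_real r * u))"
      using dyadic[OF u r(1), of n] r c unfolding R_def by (intro mult_left_mono) auto
    also have "\<dots> \<le> (1 + c) * (A * (2 * ((1 - \<rho>) / (1 - r)) powr \<delta>) * bdist (of_real r * u))"
    proof (intro mult_left_mono mult_right_mono bdist_nonneg)
      have "1 / 2 ^ n \<le> 2 * ((1 - \<rho>) / (1 - r))" using nX(2) r by (simp add: X_def field_simps)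
      then have "q ^ n \<le> (2 * ((1 - \<rho>) / (1 - r))) powr \<delta>"
        unfolding q_powr using \<delta> by (intro powr_mono2) auto
      also have "\<dots> = 2 powr \<delta> * ((1 - \<rho>) / (1 - r)) powr \<delta>" by (rule powr_mult)
      also have "\<dots> \<le> 2 * ((1 - \<rho>) / (1 - r)) powr \<delta>"
        using \<delta> powr_mono[of \<delta> 1 "2::real"] by (intro mult_right_mono) auto
      finally show "q ^ n \<le> 2 * ((1 - \<rho>) / (1 - r)) powr \<delta>" .
    qed (use A c in auto)
    finally show "bdist (of_real \<rho> * u) \<le> 2 * (1 + c) * A * ((1 - \<rho>) / (1 - r)) powr \<delta> * bdist (of_real r * u)"
      by (simp only: mult_ac)
  qed
qed

text \<open>Walks along the arc in 13 equal steps. As 4 pi < 13, each is short enough for the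
  Lipschitz bound, and each raises the boundary distance by a factor of at most 1 + L. The form C -
  1 leaves exactly C as the bound for the ratio of boundary distances.\<close>

lemma arc_oscillation:
  "\<exists>C\<ge>1. \<forall>z\<in>unit_disk. \<forall>\<phi>. \<bar>\<phi>\<bar> \<le> pi * (1 - norm z) \<longrightarrow> norm (f (z * cis \<phi>) - f z) \<le> (C - 1) * bdist z"
proof -
  obtain L where L: "1 \<le> L" "\<And>z \<zeta>. z\<in>unit_disk \<Longrightarrow> norm (\<zeta> - z) \<le> (1 - norm z) / 4 \<Longrightarrow>
     norm (f \<zeta> - f z) \<le> L * bdist z * (norm (\<zeta> - z) / (1 - norm z))"
    using local_lipschitz by blast
  show ?thesis
  proof (intro exI[of _ "(1 + L) ^ 13"] conjI ballI allI impI)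
    show "1 \<le> (1 + L) ^ 13" using L(1) by (intro one_le_power) simp
    fix z \<phi> assume z: "z \<in> unit_disk" and \<phi>: "\<bar>\<phi>\<bar> \<le> pi * (1 - norm z)"
    define w where "w j = z * cis (\<phi> * real j / 13)" for j :: nat
    have nw: "norm (w j) = norm z" for j by (simp add: w_def norm_mult)
    have step: "norm (f (w (Suc j)) - f (w j)) \<le> L * bdist (w j)" for j
    proof -
      have "norm (w (Suc j) - w j) = norm z * norm (cis (\<phi> * real (Suc j) / 13) - cis (\<phi> * real j / 13))"
        unfolding w_def by (simp flip: right_diff_distrib add: norm_mult)
      also have "\<dots> \<le> 1 * \<bar>\<phi> * real (Suc j) / 13 - \<phi> * real j / 13\<bar>"
        using z by (intro mult_mono norm_cis_diff_le) auto
      also have "\<dots> = \<bar>\<phi>\<bar> / 13" by (simp add: field_simps)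
      also have "\<dots> \<le> pi * (1 - norm z) / 13" using \<phi> by simp
      also have "\<dots> \<le> (1 - norm z) / 4" using pi_less_4 z mult_right_mono[of "pi * 4" 13 "1 - norm z"] pi_approx by simp
      finally have small: "norm (w (Suc j) - w j) \<le> (1 - norm (w j)) / 4" by (simp add: nw)
      have "norm (f (w (Suc j)) - f (w j)) \<le> L * bdist (w j) * (norm (w (Suc j) - w j) / (1 - norm (w j)))"
        by (rule L(2)[OF _ small]) (use z nw in simp)
      also have "\<dots> \<le> L * bdist (w j) * 1"
        using small z L(1) nw by (intro mult_left_mono mult_nonneg_nonneg bdist_nonneg) (auto simp: field_simps)
      finally show ?thesis by simp
    qed
    have "norm (f (w j) - f z) \<le> ((1 + L) ^ j - 1) * bdist z" for j
    proof (induction j)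
      case (Suc j)
      have "bdist (w j) \<le> (1 + L) ^ j * bdist z"
        using bdist_lipschitz[of "w j" z] Suc by (simp add: algebra_simps)
      then have "L * bdist (w j) \<le> L * ((1 + L) ^ j * bdist z)" using L(1) by (intro mult_left_mono) auto
      then have "norm (f (w (Suc j)) - f (w j)) \<le> L * ((1 + L) ^ j * bdist z)" using step[of j] by linarith
      moreover have "norm (f (w (Suc j)) - f z) \<le> norm (f (w (Suc j)) - f (w j)) + norm (f (w j) - f z)"
        using norm_triangle_ineq[of "f (w (Suc j)) - f (w j)" "f (w j) - f z"] by simp
      ultimately show ?case using Suc by (simp add: algebra_simps)
    qed (simp add: w_def)
    from this[of 13] show "norm (f (z * cis \<phi>) - f z) \<le> ((1 + L) ^ 13 - 1) * bdist z" by (simp add: w_def)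
  qed
qed

theorem Hoelder_on_Carleson_boxes:
  "\<exists>\<delta> C. 0 < \<delta> \<and> \<delta> < 1 \<and> 0 < C \<and> (\<forall>z\<in>unit_disk - {0}. \<forall>\<zeta>\<^sub>1\<in>Carleson_box z. \<forall>\<zeta>\<^sub>2\<in>Carleson_box z.
     norm (f \<zeta>\<^sub>1 - f \<zeta>\<^sub>2) \<le> C * bdist z * (norm (\<zeta>\<^sub>1 - \<zeta>\<^sub>2) / (1 - norm z)) powr \<delta>)"
proof -
  obtain L where L: "1 \<le> L" "\<And>z \<zeta>. z\<in>unit_disk \<Longrightarrow> norm (\<zeta> - z) \<le> (1 - norm z) / 4 \<Longrightarrow>
     norm (f \<zeta> - f z) \<le> L * bdist z * (norm (\<zeta> - z) / (1 - norm z))"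
    using local_lipschitz by blast
  obtain \<delta> C where \<delta>: "0 < \<delta>" "\<delta> < 1" and C: "0 < C" and decay: "\<And>(u::complex) (r::real) (\<rho>::real). norm u = 1 \<Longrightarrow> 0 \<le> r \<Longrightarrow> r \<le> \<rho> \<Longrightarrow> \<rho> < 1 \<Longrightarrow>
     bdist (of_real \<rho> * u) \<le> C * ((1 - \<rho>) / (1 - r)) powr \<delta> * bdist (of_real r * u)"
    using bdist_decay by metis
  obtain B where B: "1 \<le> B" and arc: "\<And>z \<phi>. z\<in>unit_disk \<Longrightarrow> \<bar>\<phi>\<bar> \<le> pi * (1 - norm z) \<Longrightarrow> norm (f (z * cis \<phi>) - f z) \<le> (B - 1) * bdist z"
    using arc_oscillation by blast
  show ?thesis
  \<comment> \<open>One summand per contribution: direct Lipschitz bound, two radial legs with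
    factor 5 each, Lipschitz crossing, and crossing through f z along the circle of z.\<close>
  proof (rule exI[of _ \<delta>], rule exI[of _ "L * C * B + 10 * c * C * B + 5 * L * C * B + 10 * B"], intro conjI ballI \<delta>)
    have pos: "0 < L * C * B" "0 < c * C * B" "0 < B" using L C B c by auto
    have "0 < 10 * c * C * B" "0 < 5 * L * C * B" "0 < 10 * B" using L C B c by auto
    note pos = pos this
    show "0 < L * C * B + 10 * c * C * B + 5 * L * C * B + 10 * B" using pos by linarith
    fix z \<zeta>1 \<zeta>2 assume z: "z \<in> unit_disk - {0}" and box: "\<zeta>1 \<in> Carleson_box z" "\<zeta>2 \<in> Carleson_box z"
    define r where "r = norm z"
    define t where "t = norm (\<zeta>1 - \<zeta>2)"
    define Q where "Q = (t / (1 - r)) powr \<delta>"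
    define d where "d = bdist z"
    have zD: "z \<in> unit_disk" "z \<noteq> 0" using z by auto
    have r: "0 \<le> r" "r < 1" using zD by (auto simp: r_def)
    have d: "0 \<le> d" unfolding d_def by (rule bdist_nonneg)
    have Q0: "0 \<le> Q" by (simp add: Q_def)
    have box': "r \<le> norm \<zeta>1" "norm \<zeta>1 < 1" "r \<le> norm \<zeta>2" "norm \<zeta>2 < 1"
      using box by (auto simp: Carleson_box_def r_def)
    obtain u1 \<phi>1 where u1: "norm u1 = 1" "\<zeta>1 = of_real (norm \<zeta>1) * u1" "of_real r * u1 = z * cis \<phi>1" "\<bar>\<phi>1\<bar> \<le> pi * (1 - norm z)"
      unfolding r_def using Carleson_box_polar[OF box(1) zD(2)] by metis
    obtain u2 \<phi>2 where u2: "norm u2 = 1" "\<zeta>2 = of_real (norm \<zeta>2) * u2" "of_real r * u2 = z * cis \<phi>2" "\<bar>\<phi>2\<bar> \<le> pi * (1 - norm z)"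
      unfolding r_def using Carleson_box_polar[OF box(2) zD(2)] by metis
    have a1: "norm (f (of_real r * u1) - f z) \<le> (B - 1) * d" unfolding u1(3) d_def by (rule arc[OF zD(1) u1(4)])
    have a2: "norm (f (of_real r * u2) - f z) \<le> (B - 1) * d" unfolding u2(3) d_def by (rule arc[OF zD(1) u2(4)])
    have dr1: "bdist (of_real r * u1) \<le> B * d"
      using bdist_lipschitz[of "of_real r * u1" z] a1 by (simp add: d_def algebra_simps)
    have dr2: "bdist (of_real r * u2) \<le> B * d"
      using bdist_lipschitz[of "of_real r * u2" z] a2 by (simp add: d_def algebra_simps)
    have dec: "bdist (of_real \<rho> * u) \<le> C * B * d * ((1 - \<rho>) / (1 - r)) powr \<delta>"
      if "norm u = 1" "bdist (of_real r * u) \<le> B * d" "r \<le> \<rho>" "\<rho> < 1" for u \<rho>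
    proof -
      have "bdist (of_real \<rho> * u) \<le> C * ((1 - \<rho>) / (1 - r)) powr \<delta> * bdist (of_real r * u)"
        by (rule decay) (use that r in auto)
      also have "\<dots> \<le> C * ((1 - \<rho>) / (1 - r)) powr \<delta> * (B * d)"
        using that C by (intro mult_left_mono) auto
      finally show ?thesis by (simp add: mult_ac)
    qed
    have "norm (f \<zeta>1 - f \<zeta>2) \<le> (L * C * B + 10 * c * C * B + 5 * L * C * B + 10 * B) * d * Q"
    proof (cases "t \<le> (1 - norm \<zeta>1) / 4")
      case True
      let ?y = "t / (1 - norm \<zeta>1)"
      have y: "0 \<le> ?y" "?y \<le> 1" using True box' by (auto simp: t_def field_simps)
      \<comment> \<open>The Lipschitz bound is linear in y; since y \<le> 1 it may be weakened to y
        powr \<delta>, whose product with the decay factor is exactly \<open>Q\<close>.\<close>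
      have "?y powr 1 \<le> ?y powr \<delta>" using y \<delta> by (intro powr_mono') auto
      then have yy: "?y \<le> ?y powr \<delta>" by (simp only: powr_one[OF y(1)])
      have "norm (f \<zeta>1 - f \<zeta>2) = norm (f \<zeta>2 - f \<zeta>1)" by (rule norm_minus_commute)
      also have "\<dots> \<le> L * bdist \<zeta>1 * ?y"
        using L(2)[of \<zeta>1 \<zeta>2] True box' by (simp add: t_def norm_minus_commute)
      also have "\<dots> \<le> L * (C * B * d * ((1 - norm \<zeta>1) / (1 - r)) powr \<delta>) * ?y powr \<delta>"
        using dec[OF u1(1) dr1 box'(1,2)] u1(2) L(1) bdist_nonneg[of \<zeta>1] y yy C B d
        by (intro mult_mono mult_left_mono) auto
      also have "\<dots> = L * C * B * d * (((1 - norm \<zeta>1) / (1 - r)) powr \<delta> * ?y powr \<delta>)" by (simp add: mult_ac)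
      also have "((1 - norm \<zeta>1) / (1 - r)) powr \<delta> * ?y powr \<delta> = Q"
        using y box' r by (subst powr_mult[symmetric]) (auto simp: Q_def)
      also have "L * C * B * d * Q \<le> (L * C * B + 10 * c * C * B + 5 * L * C * B + 10 * B) * d * Q"
        using pos by (intro mult_right_mono d Q0) linarith
      finally show ?thesis .
    next
      case False
      then have t4: "1 - norm \<zeta>1 < 4 * t" by simp
      then have t: "0 < t" using box' by simp
      have "norm \<zeta>1 \<le> norm \<zeta>2 + t" using norm_triangle_sub[of \<zeta>1 \<zeta>2] by (simp add: t_def)
      then have t5: "1 - norm \<zeta>2 < 5 * t" using t4 by simp
      \<comment> \<open>Both points are within 5 t of the unit circle, so radius 1 - 5 t lies inside
        both, and t is then less than a quarter of the distance 1 - \<rho> needed for crossing. The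
        cap 1 - r keeps \<rho> from dropping below |z|.\<close>
      define s where "s = min (5 * t) (1 - r)"
      define \<rho> where "\<rho> = 1 - s"
      have s: "0 < s" "s \<le> 5 * t" "s \<le> 1 - r" using t r by (auto simp: s_def)
      have \<rho>: "r \<le> \<rho>" "\<rho> < 1" "\<rho> \<le> norm \<zeta>1" "\<rho> \<le> norm \<zeta>2"
        using s t4 t5 t box' by (auto simp: \<rho>_def s_def)
      have sQ: "(s / (1 - r)) powr \<delta> \<le> 5 * Q"
      proof -
        have "(s / (1 - r)) powr \<delta> \<le> (5 * (t / (1 - r))) powr \<delta>"
          using s r \<delta> by (intro powr_mono2) (auto simp: divide_right_mono)
        also have "\<dots> = 5 powr \<delta> * Q" using t r by (subst powr_mult) (auto simp: Q_def)
        also have "\<dots> \<le> 5 * Q" using \<delta> powr_mono[of \<delta> 1 "5::real"] Q0 by (intro mult_right_mono) auto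
        finally show ?thesis .
      qed
      have db: "bdist (of_real \<rho> * u) \<le> C * B * d * (5 * Q)"
        if "norm u = 1" "bdist (of_real r * u) \<le> B * d" for u
      proof -
        have "bdist (of_real \<rho> * u) \<le> C * B * d * (s / (1 - r)) powr \<delta>"
          using dec[OF that \<rho>(1,2)] by (simp add: \<rho>_def)
        also have "\<dots> \<le> C * B * d * (5 * Q)" using sQ C B d by (intro mult_left_mono) auto
        finally show ?thesis .
      qed
      have rad: "norm (f \<zeta> - f (of_real \<rho> * u)) \<le> c * (C * B * d * (5 * Q))"
        if u: "norm u = 1" "bdist (of_real r * u) \<le> B * d" and \<zeta>: "\<zeta> = of_real (norm \<zeta>) * u" "\<rho> \<le> norm \<zeta>" "norm \<zeta> < 1" for u \<zeta>
      proof -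
        have "norm (f \<zeta> - f (of_real \<rho> * u)) \<le> c * bdist (of_real \<rho> * u)"
          using radial_oscillation[OF u(1), of \<rho> "norm \<zeta>"] \<zeta> \<rho> r by simp
        also have "\<dots> \<le> c * (C * B * d * (5 * Q))" using db[OF u] c by (intro mult_left_mono) auto
        finally show ?thesis .
      qed
      have mid: "norm (f (of_real \<rho> * u1) - f (of_real \<rho> * u2)) \<le> L * (C * B * d * (5 * Q)) + 10 * B * d * Q"
      proof (cases "5 * t \<le> 1 - r")
        case True
        then have s5: "s = 5 * t" by (simp add: s_def)
        have near: "norm (of_real \<rho> * u2 - of_real \<rho> * u1) \<le> t"
        proof -
          have "norm (of_real \<rho> * u1 - of_real \<rho> * u2) \<le> norm (of_real (norm \<zeta>1) * u1 - of_real (norm \<zeta>2) * u2)"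
            by (rule radial_projection_contracts) (use u1 u2 \<rho> r in auto)
          then show ?thesis using u1(2) u2(2) by (simp add: t_def norm_minus_commute)
        qed
        have n\<rho>: "norm (of_real \<rho> * u1) = \<rho>" using u1(1) \<rho> r by (simp add: norm_mult)
        have le1: "norm (of_real \<rho> * u2 - of_real \<rho> * u1) / (1 - norm (of_real \<rho> * u1)) \<le> 1"
          unfolding n\<rho> using near s5 t by (simp add: \<rho>_def)
        have "norm (f (of_real \<rho> * u1) - f (of_real \<rho> * u2)) = norm (f (of_real \<rho> * u2) - f (of_real \<rho> * u1))" by (rule norm_minus_commute)
        also have "\<dots> \<le> L * bdist (of_real \<rho> * u1) * (norm (of_real \<rho> * u2 - of_real \<rho> * u1) / (1 - norm (of_real \<rho> * u1)))"
        proof (rule L(2))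
          show "of_real \<rho> * u1 \<in> unit_disk" using n\<rho> \<rho> by simp
          show "norm (of_real \<rho> * u2 - of_real \<rho> * u1) \<le> (1 - norm (of_real \<rho> * u1)) / 4"
            unfolding n\<rho> using near s5 t by (simp add: \<rho>_def)
        qed
        also have "\<dots> \<le> L * bdist (of_real \<rho> * u1) * 1"
          using L(1) bdist_nonneg le1 by (intro mult_left_mono) auto
        also have "\<dots> \<le> L * (C * B * d * (5 * Q))" using db[OF u1(1) dr1] L(1) by simp
        also have "\<dots> \<le> L * (C * B * d * (5 * Q)) + 10 * B * d * Q" using B d Q0 by simp
        finally show ?thesis .
      next
        case False
        \<comment> \<open>Here t is comparable with 1 - r, so \<open>Q\<close> is bounded below and
          the crossing may cost a full multiple of d.\<close>
        then have \<rho>r: "\<rho> = r" "1 / 5 \<le> t / (1 - r)" using r by (auto simp: \<rho>_def s_def field_simps)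
        have "1 / 5 \<le> (1 / 5 :: real) powr \<delta>" using powr_mono'[of \<delta> 1 "1/5::real"] \<delta> by simp
        also have "\<dots> \<le> Q" unfolding Q_def using \<rho>r \<delta> by (intro powr_mono2) auto
        finally have Q5: "1 \<le> 5 * Q" by simp
        have "norm (f (of_real \<rho> * u1) - f (of_real \<rho> * u2)) \<le> norm (f (of_real r * u1) - f z) + norm (f (of_real r * u2) - f z)"
          unfolding \<rho>r using norm_triangle_ineq4[of "f (of_real r * u1) - f z" "f (of_real r * u2) - f z"] by simp
        also have "\<dots> \<le> 2 * B * d * 1" using a1 a2 d by (simp add: algebra_simps)
        also have "\<dots> \<le> 2 * B * d * (5 * Q)" using Q5 B d by (intro mult_left_mono) auto
        also have "\<dots> \<le> L * (C * B * d * (5 * Q)) + 10 * B * d * Q" using L C B d Q0 by simp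
        finally show ?thesis .
      qed
      have "norm (f \<zeta>1 - f \<zeta>2) \<le> norm (f \<zeta>1 - f (of_real \<rho> * u1)) + norm (f (of_real \<rho> * u1) - f (of_real \<rho> * u2)) + norm (f \<zeta>2 - f (of_real \<rho> * u2))"
        using norm_triangle_ineq[of "f \<zeta>1 - f (of_real \<rho> * u1)" "f (of_real \<rho> * u1) - f (of_real \<rho> * u2)"]
          norm_triangle_ineq4[of "f \<zeta>1 - f (of_real \<rho> * u2)" "f \<zeta>2 - f (of_real \<rho> * u2)"] by simp
      also have "\<dots> \<le> c * (C * B * d * (5 * Q)) + (L * (C * B * d * (5 * Q)) + 10 * B * d * Q) + c * (C * B * d * (5 * Q))"
        using rad[OF u1(1) dr1 u1(2) \<rho>(3) box'(2)] rad[OF u2(1) dr2 u2(2) \<rho>(4) box'(4)] mid by linarith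
      also have "\<dots> = (10 * c * C * B + 5 * L * C * B + 10 * B) * d * Q" by (simp add: algebra_simps)
      also have "\<dots> \<le> (L * C * B + 10 * c * C * B + 5 * L * C * B + 10 * B) * d * Q"
        using pos by (intro mult_right_mono d Q0) linarith
      finally show ?thesis .
    qed
    then show "norm (f \<zeta>1 - f \<zeta>2) \<le> (L * C * B + 10 * c * C * B + 5 * L * C * B + 10 * B) * bdist z * (norm (\<zeta>1 - \<zeta>2) / (1 - norm z)) powr \<delta>"
      by (simp add: d_def Q_def t_def r_def)
  qed
qed

end

section \<open>Passage to the pointwise distortion inequality, and the theorem\<close>

lemma harmonic_dilatation_everywhere:
  assumes hol: "h holomorphic_on A" "g holomorphic_on A" and A: "open A"
    and f: "\<And>z. z \<in> A \<Longrightarrow> f z = h z + cnj (g z)"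
    and ae: "AE z in lebesgue. z \<in> A \<longrightarrow>
      (op_norm_D f z)\<^sup>2 \<le> K * \<bar>(norm (wirtinger_z f z))\<^sup>2 - (norm (wirtinger_zbar f z))\<^sup>2\<bar>"
    and z: "z \<in> A"
  shows "(norm (deriv h z) + norm (deriv g z))\<^sup>2 \<le> K * \<bar>(norm (deriv h z))\<^sup>2 - (norm (deriv g z))\<^sup>2\<bar>"
proof -
  have w: "wirtinger_z f x = deriv h x" "wirtinger_zbar f x = cnj (deriv g x)" if "x \<in> A" for x
  proof -
    have "(h has_field_derivative deriv h x) (at x)" "(g has_field_derivative deriv g x) (at x)"
      using hol A that by (auto intro: holomorphic_derivI)
    then have "((\<lambda>z. h z + cnj (g z)) has_derivative (\<lambda>v. deriv h x * v + cnj (deriv g x * v))) (at x)"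
      unfolding has_field_derivative_def by (intro has_derivative_add has_derivative_cnj) auto
    then have "(f has_derivative (\<lambda>v. deriv h x * v + cnj (deriv g x * v))) (at x)"
      by (rule has_derivative_transform_within_open[OF _ A that]) (simp add: f)
    then have "frechet_derivative f (at x) = (\<lambda>v. deriv h x * v + cnj (deriv g x * v))"
      by (rule frechet_derivative_at[symmetric])
    then show "wirtinger_z f x = deriv h x" "wirtinger_zbar f x = cnj (deriv g x)"
      by (simp_all add: wirtinger_z_def wirtinger_zbar_def algebra_simps)
  qed
  \<comment> \<open>The points violating the inequality form an open set, because h' and g' are
    continuous, and a null set by hypothesis; a nonempty open set is not null.\<close>
  define N where "N = {z\<in>A. K * \<bar>(norm (deriv h z))\<^sup>2 - (norm (deriv g z))\<^sup>2\<bar> < (norm (deriv h z) + norm (deriv g z))\<^sup>2}"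
  have "open N"
  proof -
    let ?v = "\<lambda>z. (norm (deriv h z) + norm (deriv g z))\<^sup>2 - K * \<bar>(norm (deriv h z))\<^sup>2 - (norm (deriv g z))\<^sup>2\<bar>"
    have "N = A \<inter> ?v -` {0<..}" by (auto simp: N_def)
    also have "open \<dots>"
      by (rule continuous_open_preimage)
        (auto intro!: continuous_intros holomorphic_on_imp_continuous_on holomorphic_deriv hol A)
    finally show ?thesis .
  qed
  moreover have "AE z in lebesgue. z \<notin> N"
    using ae by (rule AE_mp) (auto intro!: AE_I2 simp: N_def w op_norm_D_def)
  then have "negligible N"
    using \<open>open N\<close> by (simp add: AE_iff_null_sets negligible_iff_null_sets)
  ultimately have "N = {}" using open_not_negligible by blast
  then show ?thesis using z by (auto simp: N_def not_less)
qed

theorem theorem4: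
  fixes K :: real and f :: "complex \<Rightarrow> complex" and \<Omega> :: "complex set"
  assumes "1 \<le> K"
    and "f \<in> S_H0_qc K \<Omega>"
    and "radial_John_disk f \<Omega>"
  shows "\<exists>\<delta>\<^sub>1 C\<^sub>4 :: real. 0 < \<delta>\<^sub>1 \<and> \<delta>\<^sub>1 < 1 \<and> 0 < C\<^sub>4 \<and>
    (\<forall>z\<in>unit_disk. 1 / 2 \<le> norm z \<longrightarrow>
      (\<forall>\<zeta>\<^sub>1\<in>Carleson_box z. \<forall>\<zeta>\<^sub>2\<in>Carleson_box z.
        norm (f \<zeta>\<^sub>1 - f \<zeta>\<^sub>2) \<le>
          C\<^sub>4 * boundary_dist \<Omega> (f z) * (norm (\<zeta>\<^sub>1 - \<zeta>\<^sub>2) / (1 - norm z)) powr \<delta>\<^sub>1))"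
proof -
  obtain h g where hg: "S_H_decomp f h g"
    using assms(2) by (auto simp: S_H0_qc_def S_H0_def)
  have \<Omega>: "\<Omega> = f ` unit_disk" and qc: "quasiconformal K f unit_disk \<Omega>"
    using assms(2) by (auto simp: S_H0_qc_def)
  obtain c where c: "radial_c_John_disk c f \<Omega>" using assms(3) by (auto simp: radial_John_disk_def)
  interpret radial_John_qc K f h g c
  proof
    show "1 \<le> K" by (rule assms)
    show "h holomorphic_on unit_disk" "g holomorphic_on unit_disk" "inj_on f unit_disk"
      "sense_preserving_on f unit_disk" "\<And>z. z \<in> unit_disk \<Longrightarrow> f z = h z + cnj (g z)"
      using hg by (simp_all add: S_H_decomp_def)
    then show "(norm (deriv h z) + norm (deriv g z))\<^sup>2 \<le> K * \<bar>(norm (deriv h z))\<^sup>2 - (norm (deriv g z))\<^sup>2\<bar>"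
      if "z \<in> unit_disk" for z
      by (intro harmonic_dilatation_everywhere[of h unit_disk g f]) (use qc that in \<open>auto simp: quasiconformal_def\<close>)
    show "bounded (f ` unit_disk)" "1 \<le> c" using c by (simp_all add: radial_c_John_disk_def \<Omega>)
    show "curve_length (f \<circ> linepath 0 z) s 1 \<le> ennreal (c * boundary_dist (f ` unit_disk) ((f \<circ> linepath 0 z) s))"
      if "z \<in> unit_disk" "s \<in> {0..1}" for z s
      using c that by (simp add: radial_c_John_disk_def \<Omega> Let_def)
  qed
  obtain \<delta> C where "0 < \<delta>" "\<delta> < 1" "0 < C" and
    *: "\<And>z \<zeta>1 \<zeta>2. z \<in> unit_disk - {0} \<Longrightarrow> \<zeta>1 \<in> Carleson_box z \<Longrightarrow> \<zeta>2 \<in> Carleson_box z \<Longrightarrow>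
      norm (f \<zeta>1 - f \<zeta>2) \<le> C * bdist z * (norm (\<zeta>1 - \<zeta>2) / (1 - norm z)) powr \<delta>"
    using Hoelder_on_Carleson_boxes by blast
  moreover have "norm (f \<zeta>1 - f \<zeta>2) \<le> C * boundary_dist \<Omega> (f z) * (norm (\<zeta>1 - \<zeta>2) / (1 - norm z)) powr \<delta>"
    if "z \<in> unit_disk" "1 / 2 \<le> norm z" "\<zeta>1 \<in> Carleson_box z" "\<zeta>2 \<in> Carleson_box z" for z \<zeta>1 \<zeta>2
  proof -
    have "z \<noteq> 0" using that(2) by auto
    then show ?thesis using *[of z \<zeta>1 \<zeta>2] that unfolding bdist_def \<Omega> by blast
  qed
  ultimately show ?thesis by blast
qed

end
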